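(* Let $z\in\{1,2\}$ and consider the dependent collective risk model $(N,\boldsymbol{Y}^{[N]})$ built on the t-copula conditional collective risk model with structure $z$ and degrees of freedom $\mathrm{df}>0$, as described in the context. Then the joint density function of the discrete margin $N$ and the continuous margins $\boldsymbol{Y}^{[N]}$ is $$h(n,\boldsymbol{y}^{[n]})=\begin{cases}p\,f^*_{\boldsymbol{Y}^{[n]}}(\boldsymbol{y}^{[n]})\left(\Phi_{\mathrm{df}+n}\left(\dfrac{\Phi_{\mathrm{df}}^{-1}(F_1^+(n))-\mu^*_{[n,z]}}{\sigma^*_{[n,z]}}\right)-\Phi_{\mathrm{df}+n}\left(\dfrac{\Phi_{\mathrm{df}}^{-1}(F_1^+(n-1))-\mu^*_{[n,z]}}{\sigma^*_{[n,z]}}\right)\right),&n\in\{1,2,\dots\},\ \boldsymbol{y}^{[n]}\in\mathbb{R}^n,\\[3mm]1-p,&n=0,\end{cases}$$ where, for $\boldsymbol{y}^{[n]}=(y_1,\dots,y_n)$ and $\boldsymbol{q}=\left(\Phi_{\mathrm{df}}^{-1}(F_2(y_1)),\dots,\Phi_{\mathrm{df}}^{-1}(F_2(y_n))\right)^{\mathrm T}$, $$\mu^*_{[n,z]}=\left(\rho_1\mathbf{1}_n^{\mathrm T}\right)\left(\boldsymbol{\Sigma}_{\rho_2}^{[n,z]}\right)^{-1}\boldsymbol{q},$$ $$\sigma^*_{[n,z]}=\sqrt{1-\left(\rho_1\mathbf{1}_n^{\mathrm T}\right)\left(\boldsymbol{\Sigma}_{\rho_2}^{[n,z]}\right)^{-1}\left(\rho_1\mathbf{1}_n\right)}\;\sqrt{\frac{\mathrm{df}+\boldsymbol{q}^{\mathrm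 T}\left(\boldsymbol{\Sigma}_{\rho_2}^{[n,z]}\right)^{-1}\boldsymbol{q}}{\mathrm{df}+n}},$$ $$f^*_{\boldsymbol{Y}^{[n]}}(\boldsymbol{y}^{[n]})=c_{\mathrm{df},\boldsymbol{\Sigma}_{\rho_2}^{[n,z]}}\left(F_2(y_1),\dots,F_2(y_n)\right)\prod_{i=1}^nf_2(y_i).$$
   Context: Matrices: for a positive integer $k$, $\boldsymbol{\Sigma}_{\rho_2}^{[k,1]}$ is the $k\times k$ matrix with diagonal entries $1$ and off-diagonal entries $\rho_2$; $\boldsymbol{\Sigma}_{\rho_2}^{[k,2]}$ is the $k\times k$ matrix with $(i,j)$ entry $\rho_2^{|i-j|}$ (diagonal entries $1$). For $z\in\{1,2\}$, $$\boldsymbol{\Sigma}_{\rho_1,\rho_2}^{[k,z]}=\begin{pmatrix}1&\rho_1\mathbf{1}_k^{\mathrm T}\\ \rho_1\mathbf{1}_k&\boldsymbol{\Sigma}_{\rho_2}^{[k,z]}\end{pmatrix},$$ with $\mathbf{1}_k$ the column vector of ones of length $k$. t-copula: the $d$-dimensional multivariate t-distribution $\mathrm{MVT}(\boldsymbol{0}_d,\boldsymbol{\Sigma},\mathrm{df})$ with positive definite scale matrix $\boldsymbol{\Sigma}$ has density $$\frac{\Gamma\left(\frac{d+\mathrm{df}}{2}\right)}{\Gamma\left(\frac{\mathrm{df}}{2}\right)(\pi\,\mathrm{df})^{d/2}|\boldsymbol{\Sigma}|^{1/2}}\left(1+\frac{1}{\mathrm{df}}\boldsymbol{z}^{\mathrm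 T}\boldsymbol{\Sigma}^{-1}\boldsymbol{z}\right)^{-(d+\mathrm{df})/2},\quad\boldsymbol{z}\in\mathbb{R}^d.$$ $\Phi_{\nu}$ is the distribution function of the univariate Student t-distribution with $\nu$ degrees of freedom, with $\Phi_\nu^{-1}(0)=-\infty$, $\Phi_\nu^{-1}(1)=+\infty$, $\Phi_\nu(-\infty)=0$, $\Phi_\nu(+\infty)=1$. For $\boldsymbol{\Sigma}$ with unit diagonal, $C_{\mathrm{df},\boldsymbol{\Sigma}}(u_1,\dots,u_d)=P(Z_1\le\Phi_{\mathrm{df}}^{-1}(u_1),\dots,Z_d\le\Phi_{\mathrm{df}}^{-1}(u_d))$ with $(Z_1,\dots,Z_d)\sim\mathrm{MVT}(\boldsymbol{0}_d,\boldsymbol{\Sigma},\mathrm{df})$, and $c_{\mathrm{df},\boldsymbol{\Sigma}}$ is its density on $(0,1)^d$. Conditional model: $N^+$ is a positive-integer-valued random variable with distribution function $F_1^+$; $F_2$ is a continuous distribution function on $[0,\infty)$ with probability density function $f_2$. The parameters satisfy $\rho_1,\rho_2\in(-1,1)$, with $\rho_1^2<\rho_2<1$ if $z=1$, and the matrices $\boldsymbol{\Sigma}_{\rho_2}^{[k,z]}$ and $\boldsymbol{\Sigma}_{\rho_1,\rho_2}^{[k,z]}$ are assumed positive definite for every positive integer $k$. For every positive integer $k$, $$P(N^+\le n,\,Y_1\le y_1,\dots,Y_k\le y_k)=C_{\mathrm{df},\boldsymbol{\Sigma}_{\rho_1,\rho_2}^{[k,z]}}\left(F_1^+(n),F_2(y_1),\dots,F_2(y_k)\right).$$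 Dependent collective risk model: $R$ is a Bernoulli random variable with success probability $p$, independent of $(N^+,Y_1,\dots,Y_k)$ for every $k>0$. Set $N=N^+$ if $R=1$ and $N=0$ if $R=0$; and $(N,\boldsymbol{Y}^{[N]})=(N,Y_1,\dots,Y_N)$ if $N\ge1$, $(N,\boldsymbol{Y}^{[N]})=0$ if $N=0$. Meaning of density: $P(N=0)=h(0)$, and for each $n\ge1$ and Borel $B\subseteq\mathbb{R}^n$, $P(N=n,(Y_1,\dots,Y_n)\in B)=\int_Bh(n,\boldsymbol{y}^{[n]})\,d\boldsymbol{y}^{[n]}$. The density formula is read as $0$ at points where some $F_2(y_i)\in\{0,1\}$. *)

theory Defs
  imports "HOL-Probability.Probability" "Jordan_Normal_Form.Gauss_Jordan_Elimination"
    "Jordan_Normal_Form.Determinant"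
begin

text \<open>
  Matrices and vectors are those of \<^theory>\<open>Jordan_Normal_Form.Matrix\<close>, indexed from 0.
  Points of \<open>\<real>\<^sup>d\<close> in the measure-theoretic part are functions on the index set \<open>{..<d}\<close>,
  i.e. elements of \<open>space (PiM {..<d} (\<lambda>_. lborel))\<close>.
\<close>

definition pos_def_mat :: "real mat \<Rightarrow> bool" where
  "pos_def_mat A \<longleftrightarrow> square_mat A \<and> transpose_mat A = A \<and>
     (\<forall>v \<in> carrier_vec (dim_row A). v \<noteq> 0\<^sub>v (dim_row A) \<longrightarrow> 0 < scalar_prod v (A *\<^sub>v v))"

text \<open>Only meaningful for invertible matrices; \<^const>\<open>mat_inverse\<close> returns an option.\<close>

definition inv_mat :: "real mat \<Rightarrow> real mat" where
  "inv_mat A = the (mat_inverse A)"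

definition ones_vec :: "nat \<Rightarrow> real vec" where
  "ones_vec k = Matrix.vec k (\<lambda>_. 1)"

definition Sigma_claims :: "real \<Rightarrow> nat \<Rightarrow> nat \<Rightarrow> real mat" where
  "Sigma_claims \<rho>2 k z = Matrix.mat k k (\<lambda>(i, j).
     if z = 1 then (if i = j then 1 else \<rho>2) else \<rho>2 ^ nat \<bar>int i - int j\<bar>)"

definition Sigma_joint :: "real \<Rightarrow> real \<Rightarrow> nat \<Rightarrow> nat \<Rightarrow> real mat" where
  "Sigma_joint \<rho>1 \<rho>2 k z = four_block_mat
     (1\<^sub>m 1)                      (Matrix.mat 1 k (\<lambda>_. \<rho>1))
     (Matrix.mat k 1 (\<lambda>_. \<rho>1))   (Sigma_claims \<rho>2 k z)"

definition student_t :: "real \<Rightarrow> real measure" where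
  "student_t \<nu> = density lborel (\<lambda>x. ennreal
     (Gamma ((\<nu> + 1) / 2) / (Gamma (\<nu> / 2) * sqrt (\<nu> * pi))
       * (1 + x\<^sup>2 / \<nu>) powr (- (\<nu> + 1) / 2)))"

definition t_cdf :: "real \<Rightarrow> ereal \<Rightarrow> real" where
  "t_cdf \<nu> x = measure (student_t \<nu>) {t. ereal t \<le> x}"

text \<open>The quantile function is only used for arguments in \<open>[0,1]\<close>.\<close>

definition t_quantile :: "real \<Rightarrow> real \<Rightarrow> ereal" where
  "t_quantile \<nu> u =
     (if u = 0 then -\<infinity> else if u = 1 then \<infinity>
      else ereal (THE x. t_cdf \<nu> (ereal x) = u))"

definition mvt_density :: "real \<Rightarrow> real mat \<Rightarrow> (nat \<Rightarrow> real) \<Rightarrow> real" where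
  "mvt_density df S x =
     (let d = real (dim_row S); v = Matrix.vec (dim_row S) x in
      Gamma ((d + df) / 2)
        / (Gamma (df / 2) * (pi * df) powr (d / 2) * sqrt (Determinant.det S))
        * (1 + 1 / df * scalar_prod v (inv_mat S *\<^sub>v v)) powr (- (d + df) / 2))"

definition mvt :: "real \<Rightarrow> real mat \<Rightarrow> (nat \<Rightarrow> real) measure" where
  "mvt df S = density (PiM {..<dim_row S} (\<lambda>_. lborel)) (\<lambda>x. ennreal (mvt_density df S x))"

definition t_copula :: "real \<Rightarrow> real mat \<Rightarrow> (nat \<Rightarrow> real) \<Rightarrow> real" where
  "t_copula df S u =
     measure (mvt df S)
       {x \<in> space (mvt df S). \<forall>i<dim_row S. ereal (x i) \<le> t_quantile df (u i)}"

definition is_copula_density ::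
  "nat \<Rightarrow> ((nat \<Rightarrow> real) \<Rightarrow> real) \<Rightarrow> ((nat \<Rightarrow> real) \<Rightarrow> real) \<Rightarrow> bool" where
  "is_copula_density d C c \<longleftrightarrow>
     c \<in> borel_measurable (restrict_space (PiM {..<d} (\<lambda>_. lborel)) (PiE {..<d} (\<lambda>_. {0<..<1}))) \<and>
     (\<forall>v \<in> PiE {..<d} (\<lambda>_. {0<..<1}). 0 \<le> c v) \<and>
     (\<forall>u. (\<forall>i<d. u i \<in> {0..1}) \<longrightarrow>
        ennreal (C u) =
          (\<integral>\<^sup>+ v \<in> {v \<in> PiE {..<d} (\<lambda>_. {0<..<1}). \<forall>i<d. v i \<le> u i}. ennreal (c v)
             \<partial>PiM {..<d} (\<lambda>_. lborel)))"

text \<open>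
  The density is determined up to null sets only; as for \<^const>\<open>RN_deriv\<close>, some version is chosen.
\<close>

definition t_copula_density :: "real \<Rightarrow> real mat \<Rightarrow> (nat \<Rightarrow> real) \<Rightarrow> real" where
  "t_copula_density df S = (SOME c. is_copula_density (dim_row S) (t_copula df S) c)"

text \<open>
  Independence of two random variables with values in possibly different types
  (\<^const>\<open>prob_space.indep_var\<close> requires equal types): independence of the generated
  \<open>\<sigma>\<close>-algebras.
\<close>

definition indep_rv ::
  "'a measure \<Rightarrow> 'b measure \<Rightarrow> ('a \<Rightarrow> 'b) \<Rightarrow> 'c measure \<Rightarrow> ('a \<Rightarrow> 'c) \<Rightarrow> bool" where
  "indep_rv M S X T Y \<longleftrightarrow> X \<in> measurable M S \<and> Y \<in> measurable M T \<and>
     prob_space.indep_set M {X -` A \<inter> space M | A. A \<in> sets S} {Y -` B \<inter> space M | B. B \<in> sets T}"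

text \<open>
  The claims \<open>Y\<^sub>1, Y\<^sub>2, \<dots>\<close> are \<open>Y 0, Y 1, \<dots>\<close>. In the joint copula, argument 0 belongs to
  the claim count and argument \<open>i + 1\<close> to \<open>Y i\<close>.
\<close>

definition t_copula_conditional_model ::
  "'a measure \<Rightarrow> ('a \<Rightarrow> nat) \<Rightarrow> (nat \<Rightarrow> 'a \<Rightarrow> real) \<Rightarrow> (real \<Rightarrow> real) \<Rightarrow> (real \<Rightarrow> real)
     \<Rightarrow> real \<Rightarrow> real \<Rightarrow> real \<Rightarrow> nat \<Rightarrow> bool" where
  "t_copula_conditional_model M Np Y F1 F2 df \<rho>1 \<rho>2 z \<longleftrightarrow>
     Np \<in> measurable M (count_space UNIV) \<and> (\<forall>\<omega> \<in> space M. 1 \<le> Np \<omega>) \<and>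
     F1 = cdf (distr M borel (\<lambda>\<omega>. real (Np \<omega>))) \<and>
     (\<forall>i. Y i \<in> borel_measurable M) \<and>
     (\<forall>k\<ge>1. \<forall>n y.
        measure M {\<omega> \<in> space M. Np \<omega> \<le> n \<and> (\<forall>i<k. Y i \<omega> \<le> y i)} =
        t_copula df (Sigma_joint \<rho>1 \<rho>2 k z) (case_nat (F1 (real n)) (\<lambda>i. F2 (y i))))"

definition claim_count :: "('a \<Rightarrow> bool) \<Rightarrow> ('a \<Rightarrow> nat) \<Rightarrow> 'a \<Rightarrow> nat" where
  "claim_count R Np \<omega> = (if R \<omega> then Np \<omega> else 0)"

text \<open>For a zero claim count the second component is the unique point of \<open>\<real>\<^sup>0\<close>.\<close>

definition collective_risk ::
  "('a \<Rightarrow> bool) \<Rightarrow> ('a \<Rightarrow> nat) \<Rightarrow> (nat \<Rightarrow> 'a \<Rightarrow> real) \<Rightarrow> 'a \<Rightarrow> nat \<times> (nat \<Rightarrow> real)" where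
  "collective_risk R Np Y \<omega> =
     (claim_count R Np \<omega>, restrict (\<lambda>i. Y i \<omega>) {..<claim_count R Np \<omega>})"

definition is_joint_density ::
  "'a measure \<Rightarrow> ('a \<Rightarrow> nat \<times> (nat \<Rightarrow> real)) \<Rightarrow> (nat \<Rightarrow> (nat \<Rightarrow> real) \<Rightarrow> real) \<Rightarrow> bool" where
  "is_joint_density M X h \<longleftrightarrow>
     (\<forall>y. measure M {\<omega> \<in> space M. fst (X \<omega>) = 0} = h 0 y) \<and>
     (\<forall>n\<ge>1. h n \<in> borel_measurable (PiM {..<n} (\<lambda>_. lborel)) \<and>
        (\<forall>y \<in> space (PiM {..<n} (\<lambda>_. lborel)). 0 \<le> h n y) \<and>
        (\<forall>B \<in> sets (PiM {..<n} (\<lambda>_. borel)).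
           emeasure M {\<omega> \<in> space M. fst (X \<omega>) = n \<and> snd (X \<omega>) \<in> B} =
           (\<integral>\<^sup>+ y \<in> B. ennreal (h n y) \<partial>PiM {..<n} (\<lambda>_. lborel))))"

definition q_vec :: "real \<Rightarrow> (real \<Rightarrow> real) \<Rightarrow> nat \<Rightarrow> (nat \<Rightarrow> real) \<Rightarrow> real vec" where
  "q_vec df F2 n y = Matrix.vec n (\<lambda>i. real_of_ereal (t_quantile df (F2 (y i))))"

definition mu_star ::
  "real \<Rightarrow> (real \<Rightarrow> real) \<Rightarrow> real \<Rightarrow> real \<Rightarrow> nat \<Rightarrow> nat \<Rightarrow> (nat \<Rightarrow> real) \<Rightarrow> real" where
  "mu_star df F2 \<rho>1 \<rho>2 n z y =
     scalar_prod (\<rho>1 \<cdot>\<^sub>v ones_vec n) (inv_mat (Sigma_claims \<rho>2 n z) *\<^sub>v q_vec df F2 n y)"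

definition sigma_star ::
  "real \<Rightarrow> (real \<Rightarrow> real) \<Rightarrow> real \<Rightarrow> real \<Rightarrow> nat \<Rightarrow> nat \<Rightarrow> (nat \<Rightarrow> real) \<Rightarrow> real" where
  "sigma_star df F2 \<rho>1 \<rho>2 n z y =
     (let S = inv_mat (Sigma_claims \<rho>2 n z); r = \<rho>1 \<cdot>\<^sub>v ones_vec n; q = q_vec df F2 n y in
      sqrt (1 - scalar_prod r (S *\<^sub>v r))
        * sqrt ((df + scalar_prod q (S *\<^sub>v q)) / (df + real n)))"

definition f_star ::
  "real \<Rightarrow> (real \<Rightarrow> real) \<Rightarrow> (real \<Rightarrow> real) \<Rightarrow> real \<Rightarrow> nat \<Rightarrow> nat \<Rightarrow> (nat \<Rightarrow> real) \<Rightarrow> real" where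
  "f_star df F2 f2 \<rho>2 n z y =
     t_copula_density df (Sigma_claims \<rho>2 n z) (restrict (\<lambda>i. F2 (y i)) {..<n})
       * (\<Prod>i<n. f2 (y i))"

end

theory Submission
  imports Defs
begin

text \<open>
  Let \<open>Z = (Z\<^sub>0, Z')\<close> have the multivariate t-distribution with the bordered scale matrix.
  Completing the square in the quadratic form (Schur complement) factors its density into the
  t-density of \<open>Z'\<close> and a shifted and scaled univariate t-density with \<open>df + n\<close> degrees of freedom
  in \<open>Z\<^sub>0\<close>. Hence the joint copula at \<open>(u\<^sub>0, u)\<close> is the integral of the conditional distribution
  function over the law of \<open>Z'\<close> restricted to a lower orthant. The law of the vector of
  \<open>\<Phi> (Z'\<^sub>i)\<close> has the copula density with respect to the uniform distribution on the cube, and the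
  latter is the image under \<open>F\<^sub>2\<close> (coordinatewise) of the product law with density \<open>f\<^sub>2\<close>, by the
  probability integral transform. This turns the copula into an integral over a lower orthant in
  the claim amounts; since lower orthants form an intersection-stable generator, it determines
  the measures \<open>P(N\<^sup>+ \<le> n, Y \<in> B)\<close>, and subtracting consecutive ones gives the
  density of the conditional model.
\<close>

section \<open>The probability integral transform\<close>

text \<open>Positive definiteness is given only as a condition on quadratic forms, while the
  argument needs positive determinants and total mass one: \<open>t_copula\<close> is defined
  through \<open>measure\<close>, which is 0 on sets of infinite mass. Both facts come by induction
  on the size, because for either structure \<open>Sigma_claims\<close> of size \<open>Suc k\<close>
  is itself a bordered matrix over size \<open>k\<close>. So one Schur complement computation serves
  the determinant, the normalisation and the conditional law. \<open>t_copula_density\<close> is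
  chosen by \<open>SOME\<close> and is constrained only on the open unit cube, by its integrals over
  lower orthants. Once an explicit witness shows that a density exists, the chosen one enters
  through that property alone; this is why the passage to the cube is an identity of image measures
  and not a pointwise change of variables. \<open>F2\<close> may have flat pieces, so it cannot be
  inverted. Comparing \<open>F2 (x i)\<close> with \<open>F2 (y i)\<close> amounts to comparing
  \<open>x i\<close> with \<open>y i\<close> only almost everywhere for the product law, which
  suffices under the integral.\<close>

context real_distribution
begin

lemma cdf_surj:
  assumes "continuous_on UNIV (cdf M)" "0 < u" "u < 1"
  obtains x where "cdf M x = u"
proof -
  obtain a where a: "cdf M a < u"
    using order_tendstoD(2)[OF cdf_lim_at_bot \<open>0 < u\<close>] by (auto simp: eventually_at_bot_linorder)
  obtain b where b: "u < cdf M b"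
    using order_tendstoD(1)[OF cdf_lim_at_top_prob \<open>u < 1\<close>] by (auto simp: eventually_at_top_linorder)
  have "a \<le> b" using a b cdf_nondecreasing[of b a] by linarith
  with IVT'[of "cdf M" a u b] a b assms(1) that show ?thesis
    by (auto intro: continuous_on_subset)
qed

text \<open>The distribution function may be flat, so no inverse is at hand. For a level strictly
  between 0 and 1 the sublevel set is closed by continuity, bounded above and downward closed: it is
  a half-line ending at the last point where the level is attained, and that point gives its
  mass.\<close>

lemma prob_cdf_le:
  assumes cont: "continuous_on UNIV (cdf M)" and u: "0 \<le> u" "u \<le> 1"
  shows "prob {x. cdf M x \<le> u} = u"
proof -
  have [measurable]: "cdf M \<in> borel_measurable borel"
    using cont by (rule borel_measurable_continuous_onI)
  have *: "prob {x. cdf M x \<le> u} = u" if u: "0 < u" "u < 1" for u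
  proof -
    define S where "S = {x. cdf M x \<le> u}"
    obtain x0 where x0: "cdf M x0 = u" using cdf_surj[OF cont u] .
    obtain b where b: "u < cdf M b"
      using order_tendstoD(1)[OF cdf_lim_at_top_prob \<open>u < 1\<close>] by (auto simp: eventually_at_top_linorder)
    have bdd: "bdd_above S"
    proof (rule bdd_aboveI[of _ b])
      fix x assume "x \<in> S"
      thus "x \<le> b" using b cdf_nondecreasing[of b x] by (cases "x \<le> b") (auto simp: S_def)
    qed
    have "closed S"
      unfolding S_def using cont by (intro closed_Collect_le) auto
    hence "Sup S \<in> S" using x0 bdd by (intro closed_contains_Sup) (auto simp: S_def)
    hence "S = {..Sup S}"
      using cSup_upper[OF _ bdd] cdf_nondecreasing order_trans unfolding S_def by blast
    moreover have "cdf M (Sup S) = u"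
    proof (rule antisym)
      show "cdf M (Sup S) \<le> u" using \<open>Sup S \<in> S\<close> by (simp add: S_def)
      show "u \<le> cdf M (Sup S)"
        using x0 cSup_upper[OF _ bdd, of x0] cdf_nondecreasing[of x0 "Sup S"] by (simp add: S_def)
    qed
    ultimately show ?thesis by (simp add: S_def cdf_def)
  qed
  consider "u = 0" | "u = 1" | "0 < u" "u < 1" using u by linarith
  thus ?thesis
  proof cases
    case 1
    \<comment> \<open>At level 0 the sublevel set need not have a largest element. It is contained
      in the sublevel sets of small positive levels; the minimum with 1/2 keeps such a level inside
      (0,1).\<close>
    have "prob {x. cdf M x \<le> 0} \<le> e" if "e > 0" for e
    proof -
      have "prob {x. cdf M x \<le> 0} \<le> prob {x. cdf M x \<le> min e (1/2)}"
        using that by (intro finite_measure_mono) auto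
      also have "\<dots> \<le> e" using that by (subst *) auto
      finally show ?thesis .
    qed
    hence "prob {x. cdf M x \<le> 0} \<le> 0 + e" if "e > 0" for e using that by simp
    hence "prob {x. cdf M x \<le> 0} \<le> 0" by (rule field_le_epsilon)
    with 1 show ?thesis by (simp add: antisym)
  next
    case 2
    thus ?thesis using prob_space cdf_bounded_prob by simp
  qed (rule *)
qed

lemma distr_cdf:
  assumes cont: "continuous_on UNIV (cdf M)"
  shows "distr M borel (cdf M) = uniform_measure lborel {0<..<1}"
proof (rule cdf_unique)
  have [measurable]: "cdf M \<in> borel_measurable borel"
    using cont by (rule borel_measurable_continuous_onI)
  show rd: "real_distribution (distr M borel (cdf M))" by simp
  have "prob_space (uniform_measure lborel {0<..<1::real})"
    by (rule prob_space_uniform_measure) auto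
  thus "real_distribution (uniform_measure lborel {0<..<1::real})"
    by (simp add: real_distribution_def real_distribution_axioms_def)
  then interpret U: real_distribution "uniform_measure lborel {0<..<1::real}" .
  show "cdf (distr M borel (cdf M)) = cdf (uniform_measure lborel {0<..<1})"
  proof
    fix u :: real
    have L: "cdf (distr M borel (cdf M)) u = prob {x. cdf M x \<le> u}"
      unfolding cdf_def[of "distr _ _ _"] by (subst measure_distr) (auto simp: vimage_def)
    consider "u < 0" | "0 \<le> u" "u \<le> 1" | "u > 1" by linarith
    then show "cdf (distr M borel (cdf M)) u = cdf (uniform_measure lborel {0<..<1}) u"
    proof cases
      case 1
      have "{x. cdf M x \<le> u} = {}" using 1 cdf_nonneg by (auto simp: not_le intro: less_le_trans)
      moreover have "{0<..<1} \<inter> {..u} = {}" using 1 by auto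
      ultimately show ?thesis unfolding L by (simp add: cdf_def measure_uniform_measure)
    next
      case 2
      have "emeasure lborel ({0<..<1} \<inter> {..u}) = ennreal u"
      proof (cases "u = 1")
        case True
        hence "{0<..<1} \<inter> {..u} = {0<..<1}" by auto
        thus ?thesis using True by simp
      next
        case False
        hence "{0<..<1} \<inter> {..u} = {0<..u}" using 2 by auto
        thus ?thesis using 2 by simp
      qed
      thus ?thesis unfolding L using 2 prob_cdf_le[OF cont]
        by (simp add: cdf_def measure_def divide_ennreal_def)
    next
      case 3
      have "{x. cdf M x \<le> u} = UNIV" using 3 cdf_bounded_prob by (auto intro: less_imp_le order_trans)
      moreover have "{0<..<1} \<inter> {..u} = {0<..<1}" using 3 by auto
      ultimately show ?thesis unfolding L using prob_space 
        by (simp add: cdf_def measure_uniform_measure)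
    qed
  qed
qed

text \<open>The half-line up to \<open>y\<close> lies in the sublevel set at \<open>cdf M y\<close>,
  and both have mass \<open>cdf M y\<close>. Their difference, a flat piece to the right of
  \<open>y\<close>, is therefore null. This stands in for injectivity of \<open>F2\<close>.\<close>

lemma AE_cdf_le_iff:
  assumes cont: "continuous_on UNIV (cdf M)"
  shows "AE x in M. cdf M x \<le> cdf M y \<longleftrightarrow> x \<le> y"
proof -
  have [measurable]: "cdf M \<in> borel_measurable borel"
    using cont by (rule borel_measurable_continuous_onI)
  have sub: "{..y} \<subseteq> {x. cdf M x \<le> cdf M y}" using cdf_nondecreasing by auto
  have "prob ({x. cdf M x \<le> cdf M y} - {..y}) = prob {x. cdf M x \<le> cdf M y} - prob {..y}"
    by (intro finite_measure_Diff sub) auto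
  also have "\<dots> = 0"
    using prob_cdf_le[OF cont] cdf_nonneg cdf_bounded_prob by (simp add: cdf_def)
  finally have "AE x in M. x \<notin> {x. cdf M x \<le> cdf M y} - {..y}"
    by (subst (asm) prob_eq_0) auto
  thus ?thesis by eventually_elim (use cdf_nondecreasing in auto)
qed

end

section \<open>The univariate Student distribution\<close>

text \<open>Substitution of \<open>b * t\<close> in the Gamma integral. The normalisation of the
  Student density reads it in both directions: to write a negative power as an integral over rates,
  and to evaluate the integral that remains after \<open>x\<close> is integrated out.\<close>

lemma nn_integral_Gamma_scaled:
  fixes s b :: real
  assumes "s > 0" "b > 0"
  shows "(\<integral>\<^sup>+t. ennreal (indicator {0..} t * t powr (s - 1) * exp (- (b * t))) \<partial>lborel)
    = ennreal (Gamma s / b powr s)" (is "?I = _")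
proof -
  have "ennreal (Gamma s) = (\<integral>\<^sup>+t. ennreal (indicator {0..} t * t powr (s - 1) / exp t) \<partial>lborel)"
    using assms by (simp add: Gamma_conv_nn_integral_real)
  also have "\<dots> = ennreal b *
      (\<integral>\<^sup>+t. ennreal (indicator {0..} (0 + b * t) * (0 + b * t) powr (s - 1) / exp (0 + b * t)) \<partial>lborel)"
    using assms by (subst nn_integral_real_affine[where c = b and t = 0]) auto
  also have "(\<integral>\<^sup>+t. ennreal (indicator {0..} (0 + b * t) * (0 + b * t) powr (s - 1) / exp (0 + b * t)) \<partial>lborel)
      = (\<integral>\<^sup>+t. ennreal (b powr (s - 1)) *
            ennreal (indicator {0..} t * t powr (s - 1) * exp (- (b * t))) \<partial>lborel)"
    using assms
    by (intro nn_integral_cong)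
       (auto simp: indicator_def powr_mult exp_minus divide_simps zero_le_mult_iff
             simp flip: ennreal_mult')
  also have "\<dots> = ennreal (b powr (s - 1)) * ?I"
    by (intro nn_integral_cmult) simp
  also have "ennreal b * (ennreal (b powr (s - 1)) * ?I) = ennreal (b powr s) * ?I"
    using assms by (simp add: powr_diff flip: ennreal_mult' mult.assoc)
  finally have "ennreal (Gamma s) = ennreal (b powr s) * ?I" .
  hence "ennreal (1 / b powr s) * ennreal (Gamma s)
      = ennreal (1 / b powr s) * (ennreal (b powr s) * ?I)"
    by simp
  also have "\<dots> = ?I"
    using assms by (simp flip: ennreal_mult' mult.assoc)
  also have "ennreal (1 / b powr s) * ennreal (Gamma s) = ennreal (Gamma s / b powr s)"
    by (simp flip: ennreal_mult')
  finally show ?thesis ..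
qed

lemma nn_integral_gaussian_kernel:
  fixes c :: real
  assumes "c > 0"
  shows "(\<integral>\<^sup>+x. ennreal (exp (- (c * x\<^sup>2))) \<partial>lborel) = ennreal (sqrt (pi / c))"
proof -
  \<comment> \<open>The standard deviation for which the exponent of the normal density equals
    \<open>c * x\<^sup>2\<close>.\<close>
  define \<sigma> where "\<sigma> = sqrt (1 / (2 * c))"
  have \<sigma>: "\<sigma> > 0" "2 * \<sigma>\<^sup>2 = 1 / c" using assms by (auto simp: \<sigma>_def)
  have "emeasure (density lborel (normal_density 0 \<sigma>)) UNIV = 1"
    using prob_space.emeasure_space_1[OF prob_space_normal_density[OF \<sigma>(1)], of 0] by simp
  hence one: "(\<integral>\<^sup>+x. ennreal (normal_density 0 \<sigma> x) \<partial>lborel) = 1"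
    by (simp add: emeasure_density)
  have "ennreal (exp (- (c * x\<^sup>2))) = ennreal (sqrt (pi / c)) * ennreal (normal_density 0 \<sigma> x)" for x
  proof -
    have 1: "2 * pi * \<sigma>\<^sup>2 = pi / c" and 2: "x\<^sup>2 / (2 * \<sigma>\<^sup>2) = c * x\<^sup>2"
      unfolding \<sigma>(2) using \<sigma>(2) assms by (simp_all add: field_simps)
    have "exp (- (c * x\<^sup>2)) = sqrt (pi / c) * normal_density 0 \<sigma> x"
      using assms by (simp add: normal_density_def 1 2)
    also have "ennreal \<dots> = ennreal (sqrt (pi / c)) * ennreal (normal_density 0 \<sigma> x)"
      using assms by (intro ennreal_mult normal_density_nonneg) auto
    finally show ?thesis .
  qed
  hence "(\<integral>\<^sup>+x. ennreal (exp (- (c * x\<^sup>2))) \<partial>lborel)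
      = (\<integral>\<^sup>+x. ennreal (sqrt (pi / c)) * ennreal (normal_density 0 \<sigma> x) \<partial>lborel)"
    by simp
  also have "\<dots> = ennreal (sqrt (pi / c))"
    by (subst nn_integral_cmult) (simp_all add: one)
  finally show ?thesis .
qed

definition student_density :: "real \<Rightarrow> real \<Rightarrow> real" where
  "student_density \<nu> x = Gamma ((\<nu> + 1) / 2) / (Gamma (\<nu> / 2) * sqrt (\<nu> * pi))
       * (1 + x\<^sup>2 / \<nu>) powr (- (\<nu> + 1) / 2)"

lemma student_t_alt: "student_t \<nu> = density lborel (\<lambda>x. ennreal (student_density \<nu> x))"
  by (simp add: student_t_def student_density_def)

lemma student_density_measurable [measurable]: "student_density \<nu> \<in> borel_measurable borel"
  unfolding student_density_def by measurable

lemma student_density_pos: "\<nu> > 0 \<Longrightarrow> student_density \<nu> x > 0"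
  unfolding student_density_def
  by (intro mult_pos_pos divide_pos_pos Gamma_real_pos real_sqrt_gt_zero)
     (auto intro!: add_pos_nonneg simp: add_nonneg_eq_0_iff)

text \<open>The Student density is a Gamma mixture of centred normal densities.\<close>

lemma nn_integral_student_density:
  assumes "\<nu> > 0"
  shows "(\<integral>\<^sup>+x. ennreal (student_density \<nu> x) \<partial>lborel) = 1"
proof -
  define a where "a = (\<nu> + 1) / 2"
  have a: "a > 0" "a - 1/2 = \<nu> / 2" "a > 1/2" using assms by (auto simp: a_def field_simps)
  have pos: "1 + x\<^sup>2 / \<nu> > 0" for x using assms by (auto intro!: add_pos_nonneg)
  have "(\<integral>\<^sup>+x. ennreal (Gamma a / (1 + x\<^sup>2 / \<nu>) powr a) \<partial>lborel)
      = (\<integral>\<^sup>+x. \<integral>\<^sup>+t. ennreal (indicator {0..} t * t powr (a - 1) * exp (- ((1 + x\<^sup>2 / \<nu>) * t)))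
           \<partial>lborel \<partial>lborel)"
    using a pos by (simp add: nn_integral_Gamma_scaled)
  also have "\<dots> = (\<integral>\<^sup>+t. \<integral>\<^sup>+x. ennreal (indicator {0..} t * t powr (a - 1) * exp (- ((1 + x\<^sup>2 / \<nu>) * t)))
           \<partial>lborel \<partial>lborel)"
    by (rule lborel_pair.Fubini') measurable
  \<comment> \<open>Integrating out \<open>x\<close> gives \<open>sqrt (pi * \<nu> / t)\<close>, so
    the shape parameter in \<open>t\<close> drops from \<open>a\<close> to \<open>a - 1/2\<close>,
    which is \<open>\<nu> / 2\<close>.\<close>
  also have "\<dots> = (\<integral>\<^sup>+t. ennreal (sqrt (pi * \<nu>)) *
       ennreal (indicator {0..} t * t powr ((a - 1/2) - 1) * exp (- (1 * t))) \<partial>lborel)"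
  proof (rule nn_integral_cong_AE)
    \<comment> \<open>The Gaussian integral requires a positive rate \<open>t / \<nu>\<close>.
      Negative \<open>t\<close> are killed by the indicator, and the single point 0 is discarded as
      a null set.\<close>
    have "AE t in lborel. t \<noteq> (0::real)" by (rule AE_lborel_singleton)
    then show "AE t in lborel. (\<integral>\<^sup>+x. ennreal (indicator {0..} t * t powr (a - 1) * exp (- ((1 + x\<^sup>2 / \<nu>) * t))) \<partial>lborel)
       = ennreal (sqrt (pi * \<nu>)) *
       ennreal (indicator {0..} t * t powr ((a - 1/2) - 1) * exp (- (1 * t)))"
    proof eventually_elim
      case (elim t)
      show ?case
      proof (cases "t > 0")
        case True
        have "(\<integral>\<^sup>+x. ennreal (indicator {0..} t * t powr (a - 1) * exp (- ((1 + x\<^sup>2 / \<nu>) * t))) \<partial>lborel)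
           = (\<integral>\<^sup>+x. ennreal (t powr (a - 1) * exp (- t)) * ennreal (exp (- (t / \<nu> * x\<^sup>2))) \<partial>lborel)"
          using True
          by (intro nn_integral_cong) (simp add: algebra_simps mult_exp_exp flip: ennreal_mult')
        also have "\<dots> = ennreal (t powr (a - 1) * exp (- t)) * ennreal (sqrt (pi / (t / \<nu>)))"
          using True assms by (subst nn_integral_cmult) (simp_all add: nn_integral_gaussian_kernel[of "t / \<nu>", simplified])
        also have "\<dots> = ennreal (sqrt (pi * \<nu>)) * ennreal (t powr ((a - 1/2) - 1) * exp (- t))"
        proof -
          have "t powr ((a - 1/2) - 1) = t powr ((a - 1) - 1/2)" by (simp add: algebra_simps)
          also have "\<dots> = t powr (a - 1) / sqrt t"
            using True by (subst powr_diff) (simp add: powr_half_sqrt)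
          finally show ?thesis
            using True assms
            by (simp add: real_sqrt_divide real_sqrt_mult flip: ennreal_mult')
        qed
        finally show ?thesis using True by simp
      qed (use elim in auto)
    qed
  qed
  also have "\<dots> = ennreal (sqrt (pi * \<nu>)) * ennreal (Gamma (\<nu> / 2) / 1 powr (\<nu> / 2))"
  proof -
    have "(\<integral>\<^sup>+t. ennreal (indicator {0..} t * t powr ((a - 1/2) - 1) * exp (- (1 * t))) \<partial>lborel)
      = ennreal (Gamma (a - 1/2) / 1 powr (a - 1/2))"
      using a by (intro nn_integral_Gamma_scaled) auto
    also have "\<dots> = ennreal (Gamma (\<nu> / 2) / 1 powr (\<nu> / 2))"
      unfolding a(2) ..
    finally have J: "(\<integral>\<^sup>+t. ennreal (indicator {0..} t * t powr ((a - 1/2) - 1) * exp (- (1 * t))) \<partial>lborel)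
      = ennreal (Gamma (\<nu> / 2) / 1 powr (\<nu> / 2))" .
    show ?thesis by (subst nn_integral_cmult, measurable, subst J, rule refl)
  qed
  finally have *: "(\<integral>\<^sup>+x. ennreal (Gamma a / (1 + x\<^sup>2 / \<nu>) powr a) \<partial>lborel)
      = ennreal (sqrt (pi * \<nu>) * Gamma (\<nu> / 2))"
    using assms by (simp flip: ennreal_mult')
  have G: "Gamma (\<nu> / 2) > 0" "Gamma a > 0" using assms a by auto
  have "(\<integral>\<^sup>+x. ennreal (student_density \<nu> x) \<partial>lborel)
     = (\<integral>\<^sup>+x. ennreal (1 / (Gamma (\<nu> / 2) * sqrt (\<nu> * pi))) *
             ennreal (Gamma a / (1 + x\<^sup>2 / \<nu>) powr a) \<partial>lborel)"
  proof (intro nn_integral_cong)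
    fix x :: real
    have "- (\<nu> + 1) / 2 = - ((\<nu> + 1) / 2)" by (rule minus_divide_left[symmetric])
    hence "student_density \<nu> x = 1 / (Gamma (\<nu> / 2) * sqrt (\<nu> * pi)) * (Gamma a / (1 + x\<^sup>2 / \<nu>) powr a)"
      unfolding student_density_def a_def by (simp only: powr_minus) (simp add: field_simps)
    moreover have "0 \<le> 1 / (Gamma (\<nu> / 2) * sqrt (\<nu> * pi))"
      using G assms by simp
    ultimately show "ennreal (student_density \<nu> x) = ennreal (1 / (Gamma (\<nu> / 2) * sqrt (\<nu> * pi))) *
        ennreal (Gamma a / (1 + x\<^sup>2 / \<nu>) powr a)"
      by (simp only: ennreal_mult')
  qed
  also have "\<dots> = ennreal (1 / (Gamma (\<nu> / 2) * sqrt (\<nu> * pi)))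
      * ennreal (sqrt (pi * \<nu>) * Gamma (\<nu> / 2))"
    by (subst nn_integral_cmult) (simp_all add: *)
  also have "\<dots> = 1"
  proof -
    have "Gamma (\<nu> / 2) \<noteq> 0" using G(1) by linarith
    hence "1 / (Gamma (\<nu> / 2) * sqrt (\<nu> * pi)) * (sqrt (pi * \<nu>) * Gamma (\<nu> / 2)) = 1"
      using assms by (simp add: mult.commute[of pi])
    moreover have "0 \<le> 1 / (Gamma (\<nu> / 2) * sqrt (\<nu> * pi))"
      using G assms by simp
    ultimately show ?thesis by (metis ennreal_mult' ennreal_1)
  qed
  finally show ?thesis .
qed

lemma real_distribution_student_t:
  assumes "\<nu> > 0"
  shows "real_distribution (student_t \<nu>)"
proof -
  have "prob_space (student_t \<nu>)"
    by (rule prob_spaceI) (simp add: student_t_alt emeasure_density nn_integral_student_density assms)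
  thus ?thesis
    by (simp add: real_distribution_def real_distribution_axioms_def student_t_alt)
qed

lemma t_cdf_ereal: "t_cdf \<nu> (ereal x) = cdf (student_t \<nu>) x"
  by (simp add: t_cdf_def cdf_def atMost_def)

lemma t_cdf_MInf [simp]: "t_cdf \<nu> (- \<infinity>) = 0"
  by (simp add: t_cdf_def)

lemma t_cdf_PInf: "\<nu> > 0 \<Longrightarrow> t_cdf \<nu> \<infinity> = 1"
  using prob_space.prob_space[OF real_distribution.axioms(1)[OF real_distribution_student_t]]
  by (simp add: t_cdf_def student_t_alt)

lemma t_cdf_mono:
  assumes "\<nu> > 0" "a \<le> b"
  shows "t_cdf \<nu> a \<le> t_cdf \<nu> b"
proof -
  interpret real_distribution "student_t \<nu>" by (rule real_distribution_student_t) fact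
  show ?thesis
    unfolding t_cdf_def using assms by (intro finite_measure_mono) (auto)
qed

lemma continuous_cdf_student_t:
  assumes "\<nu> > 0"
  shows "continuous_on UNIV (cdf (student_t \<nu>))"
proof -
  interpret real_distribution "student_t \<nu>" by (rule real_distribution_student_t) fact
  have "AE x in student_t \<nu>. x \<noteq> a" for a
    unfolding student_t_alt by (subst AE_density) (auto intro: AE_mp[OF AE_lborel_singleton])
  hence "measure (student_t \<nu>) {a} = 0" for a
    by (subst prob_eq_0) auto
  thus ?thesis
    by (auto simp: continuous_on_eq_continuous_at isCont_cdf)
qed

text \<open>The density is positive everywhere, so an interval without mass would be a Lebesgue null
  set.\<close>

lemma strict_mono_cdf_student_t:
  assumes "\<nu> > 0"
  shows "strict_mono (cdf (student_t \<nu>))"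
proof
  fix x y :: real assume "x < y"
  interpret real_distribution "student_t \<nu>" by (rule real_distribution_student_t) fact
  have "measure (student_t \<nu>) {x<..y} \<noteq> 0"
  proof
    assume "measure (student_t \<nu>) {x<..y} = 0"
    hence "AE t in student_t \<nu>. t \<notin> {x<..y}" by (subst (asm) prob_eq_0) auto
    hence "AE t in lborel. t \<notin> {x<..y}"
      unfolding student_t_alt using assms by (subst (asm) AE_density) (auto simp: student_density_pos)
    hence "emeasure lborel {x<..y} = 0" by (subst (asm) AE_iff_measurable[OF _ refl]) (auto simp: greaterThanAtMost_def greaterThan_def atMost_def Int_def)
    thus False using \<open>x < y\<close> by simp
  qed
  with cdf_diff_eq[OF \<open>x < y\<close>] measure_nonneg[of "student_t \<nu>" "{x<..y}"]
  show "cdf (student_t \<nu>) x < cdf (student_t \<nu>) y" by linarith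
qed

lemma cdf_student_t_unit_interval:
  assumes "\<nu> > 0"
  shows "cdf (student_t \<nu>) x \<in> {0<..<1}"
proof -
  interpret real_distribution "student_t \<nu>" by (rule real_distribution_student_t) fact
  have "cdf (student_t \<nu>) (x - 1) < cdf (student_t \<nu>) x" "cdf (student_t \<nu>) x < cdf (student_t \<nu>) (x + 1)"
    using strict_mono_cdf_student_t[OF assms] by (auto simp: strict_mono_def)
  with cdf_nonneg[of "x - 1"] cdf_bounded_prob[of "x + 1"] show ?thesis by auto
qed

lemma t_quantile_cdf:
  assumes "\<nu> > 0"
  shows "t_quantile \<nu> (cdf (student_t \<nu>) x) = ereal x"
proof -
  have "(THE y. t_cdf \<nu> (ereal y) = cdf (student_t \<nu>) x) = x"
    using strict_mono_eq[OF strict_mono_cdf_student_t[OF assms]]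
    by (intro the_equality) (auto simp: t_cdf_ereal)
  thus ?thesis using cdf_student_t_unit_interval[OF assms, of x] by (simp add: t_quantile_def)
qed

text \<open>The levels 0 and 1 fit in because the quantile is infinite there while the distribution
  function stays strictly between them. Quantile conditions can thus be exchanged for conditions on
  the distribution function with no separate treatment of the boundary.\<close>

lemma le_t_quantile_iff:
  assumes "\<nu> > 0" "0 \<le> u" "u \<le> 1"
  shows "ereal x \<le> t_quantile \<nu> u \<longleftrightarrow> cdf (student_t \<nu>) x \<le> u"
proof -
  interpret real_distribution "student_t \<nu>" by (rule real_distribution_student_t) fact
  consider "u = 0" | "u = 1" | "0 < u" "u < 1" using assms by linarith
  thus ?thesis
  proof cases
    case 3
    then obtain y where y: "cdf (student_t \<nu>) y = u"
      using cdf_surj[OF continuous_cdf_student_t[OF assms(1)]] by blast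
    have "t_quantile \<nu> u = ereal y" using t_quantile_cdf[OF assms(1), of y] y by simp
    thus ?thesis
      using strict_mono_less_eq[OF strict_mono_cdf_student_t[OF assms(1)], of x y] y by simp
  qed (use cdf_student_t_unit_interval[OF assms(1), of x] in \<open>auto simp: t_quantile_def\<close>)
qed

text \<open>The finite version that occurs in the entries of \<open>q_vec\<close>. At 0 and 1 the
  infinite quantile becomes the default value 0; there the density of the claims is set to
  zero.\<close>

definition real_t_quantile :: "real \<Rightarrow> real \<Rightarrow> real" where
  "real_t_quantile \<nu> u = real_of_ereal (t_quantile \<nu> u)"

lemma real_t_quantile_cdf: "\<nu> > 0 \<Longrightarrow> real_t_quantile \<nu> (cdf (student_t \<nu>) x) = x"
  by (simp add: real_t_quantile_def t_quantile_cdf)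

lemma real_t_quantile_measurable:
  assumes "\<nu> > 0"
  shows "real_t_quantile \<nu> \<in> borel_measurable borel"
proof -
  interpret real_distribution "student_t \<nu>" by (rule real_distribution_student_t) fact
  \<comment> \<open>Outside [0,1] the equation that defines the quantile has no solution, so
    \<open>THE\<close> is applied to the empty predicate and returns the same unspecified number for
    all such arguments.\<close>
  define c :: real where "c = (THE x. False)"
  define g where "g u = (if 0 < u \<and> u < 1 then real_t_quantile \<nu> u else 0)" for u
  have "g \<in> borel_measurable borel"
  proof (rule borel_measurableI_le)
    fix a
    have *: "real_t_quantile \<nu> u \<le> a \<longleftrightarrow> u \<le> cdf (student_t \<nu>) a" if u: "0 < u" "u < 1" for u
    proof -
      obtain y where y: "cdf (student_t \<nu>) y = u"
        using cdf_surj[OF continuous_cdf_student_t[OF assms] u] by blast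
      thus ?thesis
        using real_t_quantile_cdf[OF assms, of y] strict_mono_less_eq[OF strict_mono_cdf_student_t[OF assms], of y a]
        by simp
    qed
    have "{u \<in> space borel. g u \<le> a} = ({0<..<1} \<inter> {..cdf (student_t \<nu>) a}) \<union> (if 0 \<le> a then - {0<..<1} else {})"
      using * by (auto simp: g_def split: if_splits)
    also have "\<dots> \<in> sets borel" by (auto)
    finally show "{u \<in> space borel. g u \<le> a} \<in> sets borel" .
  qed
  hence "(\<lambda>u. if 0 < u \<and> u < 1 then g u else if u = 0 \<or> u = 1 then 0 else c) \<in> borel_measurable borel"
    by measurable
  also have "(\<lambda>u. if 0 < u \<and> u < 1 then g u else if u = 0 \<or> u = 1 then 0 else c) = real_t_quantile \<nu>"
  proof
    fix u :: real
    have "t_cdf \<nu> (ereal x) \<noteq> u" if "u < 0 \<or> u > 1" for x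
      using that cdf_student_t_unit_interval[OF assms, of x] by (auto simp: t_cdf_ereal)
    hence "(THE x. t_cdf \<nu> (ereal x) = u) = c" if "u < 0 \<or> u > 1"
      using that unfolding c_def by simp
    thus "(if 0 < u \<and> u < 1 then g u else if u = 0 \<or> u = 1 then 0 else c) = real_t_quantile \<nu> u"
      by (auto simp: g_def real_t_quantile_def t_quantile_def)
  qed
  finally show ?thesis .
qed

lemma t_quantile_mono:
  assumes "\<nu> > 0" "0 \<le> u" "u \<le> v" "v \<le> 1"
  shows "t_quantile \<nu> u \<le> t_quantile \<nu> v"
proof (rule ccontr)
  assume "\<not> t_quantile \<nu> u \<le> t_quantile \<nu> v"
  then obtain x where x: "t_quantile \<nu> v < ereal x" "ereal x < t_quantile \<nu> u"
    using ereal_dense2 unfolding not_le by blast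
  hence "cdf (student_t \<nu>) x \<le> v"
    using le_t_quantile_iff[of \<nu> u x] assms by auto
  thus False using le_t_quantile_iff[of \<nu> v x] assms x(1) by auto
qed

section \<open>Finite products of measures on the real line\<close>

text \<open>With the whole index set as the only block in \<open>sets_PiM_sigma\<close>, every
  generator bounds all coordinates at once, so finite intersections of cylinders never
  appear.\<close>

lemma sets_PiM_borel_lower_orthants:
  assumes "finite I"
  shows "sets (PiM I (\<lambda>_. borel :: real measure))
    = sigma_sets (PiE I (\<lambda>_. UNIV)) (range (\<lambda>y. {x \<in> PiE I (\<lambda>_. UNIV). \<forall>i\<in>I. x i \<le> y i}))"
proof -
  have "sets (PiM I (\<lambda>_. borel :: real measure)) = sets (PiM I (\<lambda>_. sigma UNIV (range (\<lambda>a::real. {..a}))))"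
    by (intro sets_PiM_cong refl) (simp add: borel_eq_atMost)
  also have "\<dots> = sets (sigma (PiE I (\<lambda>_. UNIV))
      {{x \<in> PiE I (\<lambda>_. UNIV). \<forall>i\<in>j. x i \<in> A i} | A j. j \<in> {I} \<and> A \<in> Pi j (\<lambda>_. range (\<lambda>a::real. {..a}))})"
  proof (rule sets_PiM_sigma)
    show "\<exists>S\<subseteq>range (\<lambda>a::real. {..a}). countable S \<and> UNIV = \<Union>S"
      by (intro exI[of _ "range (\<lambda>n::nat. {..real n})"]) (auto intro: real_arch_simple)
  qed (use assms in auto)
  also have "{{x \<in> PiE I (\<lambda>_. UNIV). \<forall>i\<in>j. x i \<in> A i} | A j. j \<in> {I} \<and> A \<in> Pi j (\<lambda>_. range (\<lambda>a::real. {..a}))}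
     = range (\<lambda>y. {x \<in> PiE I (\<lambda>_. UNIV). \<forall>i\<in>I. x i \<le> y i})" (is "?L = ?R")
  proof
    show "?L \<subseteq> ?R"
    proof
      fix X assume "X \<in> ?L"
      then obtain A where X: "X = {x \<in> PiE I (\<lambda>_. UNIV). \<forall>i\<in>I. x i \<in> A i}"
        and A: "A \<in> Pi I (\<lambda>_. range (\<lambda>a::real. {..a}))" by auto
      from A have "\<forall>i\<in>I. \<exists>a. A i = {..a}" by auto
      then obtain y where "\<forall>i\<in>I. A i = {..y i}" by metis
      hence "X = {x \<in> PiE I (\<lambda>_. UNIV). \<forall>i\<in>I. x i \<le> y i}" unfolding X by auto
      thus "X \<in> ?R" by blast
    qed
    show "?R \<subseteq> ?L"
    proof
      fix X assume "X \<in> ?R"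
      then obtain y where "X = {x \<in> PiE I (\<lambda>_. UNIV). \<forall>i\<in>I. x i \<le> y i}" by auto
      thus "X \<in> ?L" by (intro CollectI exI[of _ "\<lambda>i. {..y i}"] exI[of _ I]) auto
    qed
  qed
  also have "sets (sigma (PiE I (\<lambda>_. UNIV)) (range (\<lambda>y. {x \<in> PiE I (\<lambda>_. UNIV). \<forall>i\<in>I. x i \<le> y i})))
     = sigma_sets (PiE I (\<lambda>_. UNIV)) (range (\<lambda>y. {x \<in> PiE I (\<lambda>_. UNIV::real set). \<forall>i\<in>I. x i \<le> y i}))"
    by (intro sets_measure_of) auto
  finally show ?thesis .
qed

text \<open>Coordinatewise minima make the generator intersection-stable, and the orthants with
  constant integer bounds exhaust the space. Finiteness is asked of \<open>P\<close> only: in the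
  applications \<open>Q\<close> is a density whose total mass is not known in advance.\<close>

lemma measure_eqI_lower_orthants:
  fixes P Q :: "('i \<Rightarrow> real) measure"
  assumes "finite I" and P: "sets P = sets (PiM I (\<lambda>_. borel))" and Q: "sets Q = sets (PiM I (\<lambda>_. borel))"
    and "finite_measure P"
    and eq: "\<And>y. emeasure P {x \<in> PiE I (\<lambda>_. UNIV). \<forall>i\<in>I. x i \<le> y i}
      = emeasure Q {x \<in> PiE I (\<lambda>_. UNIV). \<forall>i\<in>I. x i \<le> y i}"
  shows "P = Q"
proof (rule measure_eqI_generator_eq)
  interpret finite_measure P by fact
  let ?O = "\<lambda>y. {x \<in> PiE I (\<lambda>_. UNIV). \<forall>i\<in>I. x i \<le> (y i :: real)}"
  show "Int_stable (range ?O)"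
  proof (rule Int_stableI)
    fix a b assume "a \<in> range ?O" "b \<in> range ?O"
    then obtain y z where "a = ?O y" "b = ?O z" by blast
    hence "a \<inter> b = ?O (\<lambda>i. min (y i) (z i))" by auto
    with rangeI[of ?O "\<lambda>i. min (y i) (z i)"] show "a \<inter> b \<in> range ?O" by simp
  qed
  show "range ?O \<subseteq> Pow (PiE I (\<lambda>_. UNIV))" by auto
  show "sets P = sigma_sets (PiE I (\<lambda>_. UNIV)) (range ?O)"
    "sets Q = sigma_sets (PiE I (\<lambda>_. UNIV)) (range ?O)"
    using P Q sets_PiM_borel_lower_orthants[OF \<open>finite I\<close>] by simp_all
  show "range (\<lambda>n::nat. ?O (\<lambda>_. real n)) \<subseteq> range ?O" by auto
  show "(\<Union>n::nat. ?O (\<lambda>_. real n)) = PiE I (\<lambda>_. UNIV)"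
  proof (intro equalityI subsetI)
    fix x assume x: "x \<in> PiE I (\<lambda>_. UNIV :: real set)"
    have "bdd_above (x ` I)" using \<open>finite I\<close> by simp
    then obtain b where b: "\<And>i. i \<in> I \<Longrightarrow> x i \<le> b" by (auto simp: bdd_above_def)
    obtain n :: nat where "b \<le> real n" using real_arch_simple by blast
    with x b show "x \<in> (\<Union>n::nat. ?O (\<lambda>_. real n))" by (auto intro!: exI[of _ n] intro: order_trans)
  qed auto
  show "emeasure P X = emeasure Q X" if "X \<in> range ?O" for X using that eq by auto
  show "emeasure P (?O (\<lambda>_. real n)) \<noteq> \<infinity>" for n by simp
qed

text \<open>On a box the indicator is a product of coordinate indicators, so the integral splits
  into one-dimensional ones; the sigma-finite weighted factors make the values on boxes
  decisive.\<close>

lemma PiM_density: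
  fixes f :: "'i \<Rightarrow> 'a \<Rightarrow> ennreal"
  assumes "finite I" and "product_sigma_finite M" and "product_sigma_finite (\<lambda>i. density (M i) (f i))"
    and [measurable]: "\<And>i. f i \<in> borel_measurable (M i)"
  shows "PiM I (\<lambda>i. density (M i) (f i)) = density (PiM I M) (\<lambda>x. \<Prod>i\<in>I. f i (x i))"
proof -
  interpret M: product_sigma_finite M by fact
  interpret D: product_sigma_finite "\<lambda>i. density (M i) (f i)" by fact
  have sets_eq: "sets (PiM I M) = sets (PiM I (\<lambda>i. density (M i) (f i)))"
    by (intro sets_PiM_cong) auto
  have [measurable]: "(\<lambda>x. \<Prod>i\<in>I. f i (x i)) \<in> borel_measurable (PiM I M)"
    by (intro borel_measurable_prod_ennreal) measurable
  show ?thesis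
  proof (rule D.PiM_eqI[symmetric])
    fix A assume "\<And>i. i \<in> I \<Longrightarrow> A i \<in> sets (density (M i) (f i))"
    hence A: "\<And>i. i \<in> I \<Longrightarrow> A i \<in> sets (M i)" by simp
    hence "PiE I A \<in> sets (PiM I M)" using \<open>finite I\<close> by (intro sets_PiM_I_finite)
    hence "emeasure (density (PiM I M) (\<lambda>x. \<Prod>i\<in>I. f i (x i))) (PiE I A)
       = (\<integral>\<^sup>+x. (\<Prod>i\<in>I. f i (x i)) * indicator (PiE I A) x \<partial>PiM I M)"
      by (intro emeasure_density) auto
    also have "\<dots> = (\<integral>\<^sup>+x. (\<Prod>i\<in>I. f i (x i) * indicator (A i) (x i)) \<partial>PiM I M)"
    proof (intro nn_integral_cong)
      fix x assume "x \<in> space (PiM I M)"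
      hence "indicator (PiE I A) x = (\<Prod>i\<in>I. indicator (A i) (x i) :: ennreal)"
        using \<open>finite I\<close> by (auto simp: indicator_def space_PiM PiE_iff prod_zero_iff)
      thus "(\<Prod>i\<in>I. f i (x i)) * indicator (PiE I A) x = (\<Prod>i\<in>I. f i (x i) * indicator (A i) (x i))"
        by (simp add: prod.distrib)
    qed
    also have "\<dots> = (\<Prod>i\<in>I. \<integral>\<^sup>+x. f i x * indicator (A i) x \<partial>M i)"
      using A \<open>finite I\<close> by (intro M.product_nn_integral_prod) auto
    also have "\<dots> = (\<Prod>i\<in>I. emeasure (density (M i) (f i)) (A i))"
      using A by (intro prod.cong refl emeasure_density[symmetric]) auto
    finally show "emeasure (density (PiM I M) (\<lambda>x. \<Prod>i\<in>I. f i (x i))) (PiE I A)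
       = (\<Prod>i\<in>I. emeasure (density (M i) (f i)) (A i))" .
  qed (use \<open>finite I\<close> sets_eq in auto)
qed

lemma sets_PiM_lborel [measurable_cong]:
  "sets (PiM I (\<lambda>_. lborel :: real measure)) = sets (PiM I (\<lambda>_. borel))"
  by (intro sets_PiM_cong) auto

text \<open>\<open>case_nat x f\<close> prepends \<open>x\<close> to \<open>f\<close>, in line with
  the convention that argument 0 of the joint copula belongs to the claim count.\<close>

lemma case_nat_mem_PiE:
  "case_nat x f \<in> PiE {..<Suc n} A \<longleftrightarrow> x \<in> A 0 \<and> f \<in> PiE {..<n} (\<lambda>i. A (Suc i))"
proof -
  have *: "(\<forall>i. P i) \<longleftrightarrow> P 0 \<and> (\<forall>i. P (Suc i))" for P :: "nat \<Rightarrow> bool"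
    by (metis nat.exhaust)
  show ?thesis
    unfolding PiE_iff extensional_def Ball_def mem_Collect_eq by (subst (1 2) *) auto
qed

lemma measurable_case_nat_PiM [measurable]:
  "(\<lambda>(x, f). case_nat x f) \<in>
     borel \<Otimes>\<^sub>M PiM {..<n} (\<lambda>_. borel :: real measure) \<rightarrow>\<^sub>M PiM {..<Suc n} (\<lambda>_. borel)"
proof (rule measurable_PiM_single')
  fix i assume i: "i \<in> {..<Suc n}"
  show "(\<lambda>w. (case w of (x, f) \<Rightarrow> case_nat x f) i) \<in> borel_measurable (borel \<Otimes>\<^sub>M PiM {..<n} (\<lambda>_. borel :: real measure))"
  proof (cases i)
    case 0
    thus ?thesis by (simp add: case_prod_beta')
  next
    case (Suc j)
    with i have "(\<lambda>w. snd w j) \<in> borel_measurable (borel \<Otimes>\<^sub>M PiM {..<n} (\<lambda>_. borel :: real measure))"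
      by (intro measurable_compose[OF measurable_snd measurable_component_singleton]) auto
    thus ?thesis using Suc by (simp add: case_prod_beta')
  qed
next
  show "(\<lambda>w i. (case w of (x, f) \<Rightarrow> case_nat x f) i) \<in>
    space (borel \<Otimes>\<^sub>M PiM {..<n} (\<lambda>_. borel :: real measure)) \<rightarrow> {..<Suc n} \<rightarrow>\<^sub>E space borel"
  proof (rule Pi_I)
    fix w assume w: "w \<in> space ((borel :: real measure) \<Otimes>\<^sub>M PiM {..<n} (\<lambda>_. borel :: real measure))"
    obtain x f where xf: "w = (x, f)" by (cases w)
    with w have "case_nat x f \<in> {..<Suc n} \<rightarrow>\<^sub>E space (borel :: real measure)"
      by (simp add: case_nat_mem_PiE space_pair_measure space_PiM)
    thus "(\<lambda>i. (case w of (x, f) \<Rightarrow> case_nat x f) i) \<in> {..<Suc n} \<rightarrow>\<^sub>E space (borel :: real measure)"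
      by (simp add: xf)
  qed
qed

text \<open>Prepending a coordinate carries the pair measure to the larger product. Coordinate 0 is
  integrated innermost because it is the one whose conditional law, with the others held fixed, is
  wanted.\<close>

lemma nn_integral_PiM_lborel_Suc:
  assumes [measurable]: "f \<in> borel_measurable (PiM {..<Suc n} (\<lambda>_. borel :: real measure))"
  shows "(\<integral>\<^sup>+x. f x \<partial>PiM {..<Suc n} (\<lambda>_. lborel))
    = (\<integral>\<^sup>+x. (\<integral>\<^sup>+x0. f (case_nat x0 x) \<partial>lborel) \<partial>PiM {..<n} (\<lambda>_. lborel))"
proof -
  interpret L: product_sigma_finite "\<lambda>_::nat. lborel :: real measure" ..
  interpret n: finite_product_sigma_finite "\<lambda>_::nat. lborel :: real measure" "{..<n}" by standard simp
  interpret P: pair_sigma_finite "lborel :: real measure" "PiM {..<n} (\<lambda>_. lborel :: real measure)" ..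
  let ?D = "distr (lborel \<Otimes>\<^sub>M PiM {..<n} (\<lambda>_. lborel)) (PiM {..<Suc n} (\<lambda>_. lborel :: real measure)) (\<lambda>(x, f). case_nat x f)"
  have m: "(\<lambda>(x, f). case_nat x f) \<in>
     lborel \<Otimes>\<^sub>M PiM {..<n} (\<lambda>_. lborel :: real measure) \<rightarrow>\<^sub>M PiM {..<Suc n} (\<lambda>_. lborel)"
    using measurable_case_nat_PiM[of n]
    by (subst measurable_cong_sets[OF sets_pair_measure_cong[OF sets_lborel sets_PiM_lborel] sets_PiM_lborel])
  have "?D = PiM {..<Suc n} (\<lambda>_. lborel)"
  proof (rule L.PiM_eqI)
    fix A :: "nat \<Rightarrow> real set" assume A: "\<And>i. i \<in> {..<Suc n} \<Longrightarrow> A i \<in> sets lborel"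
    have "emeasure ?D (PiE {..<Suc n} A) = emeasure (lborel \<Otimes>\<^sub>M PiM {..<n} (\<lambda>_. lborel))
       ((\<lambda>(x, f). case_nat x f) -` PiE {..<Suc n} A \<inter> space (lborel \<Otimes>\<^sub>M PiM {..<n} (\<lambda>_. lborel)))"
      using A by (intro emeasure_distr m sets_PiM_I_finite) auto
    also have "(\<lambda>(x, f). case_nat x f) -` PiE {..<Suc n} A \<inter> space (lborel \<Otimes>\<^sub>M PiM {..<n} (\<lambda>_. lborel))
       = A 0 \<times> PiE {..<n} (\<lambda>i. A (Suc i))"
    proof -
      have "f \<in> PiE {..<n} (\<lambda>i. A (Suc i)) \<Longrightarrow> f \<in> PiE {..<n} (\<lambda>_. UNIV)" for f
        by (auto simp: PiE_iff)
      thus ?thesis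
        by (auto simp: space_pair_measure space_PiM case_nat_mem_PiE simp del: PiE_iff)
    qed
    also have "emeasure (lborel \<Otimes>\<^sub>M PiM {..<n} (\<lambda>_. lborel)) \<dots>
       = emeasure lborel (A 0) * emeasure (PiM {..<n} (\<lambda>_. lborel)) (PiE {..<n} (\<lambda>i. A (Suc i)))"
      using A by (intro n.emeasure_pair_measure_Times sets_PiM_I_finite) auto
    also have "emeasure (PiM {..<n} (\<lambda>_. lborel)) (PiE {..<n} (\<lambda>i. A (Suc i))) = (\<Prod>i<n. emeasure lborel (A (Suc i)))"
      using A by (intro L.emeasure_PiM) auto
    finally show "emeasure ?D (PiE {..<Suc n} A) = (\<Prod>i<Suc n. emeasure lborel (A i))"
      by (simp only: prod.lessThan_Suc_shift)
  qed auto
  hence "(\<integral>\<^sup>+x. f x \<partial>PiM {..<Suc n} (\<lambda>_. lborel)) = (\<integral>\<^sup>+x. f x \<partial>?D)" by simp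
  also have "\<dots> = (\<integral>\<^sup>+w. f (case w of (x0, x) \<Rightarrow> case_nat x0 x) \<partial>(lborel \<Otimes>\<^sub>M PiM {..<n} (\<lambda>_. lborel)))"
    by (rule nn_integral_distr[OF m]) measurable
  also have "\<dots> = (\<integral>\<^sup>+x. (\<integral>\<^sup>+x0. f (case_nat x0 x) \<partial>lborel) \<partial>PiM {..<n} (\<lambda>_. lborel))"
    by (subst P.nn_integral_snd[symmetric]) (auto intro!: measurable_compose[OF m])
  finally show ?thesis .
qed

section \<open>Positive definite matrices bordered by a row and a column\<close>

lemma pos_def_matD:
  assumes "pos_def_mat S" "S \<in> carrier_mat n n"
  shows "transpose_mat S = S" "\<And>v. v \<in> carrier_vec n \<Longrightarrow> v \<noteq> 0\<^sub>v n \<Longrightarrow> 0 < v \<bullet> (S *\<^sub>v v)"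
  using assms by (auto simp: pos_def_mat_def)

text \<open>A nonzero kernel vector would annihilate the quadratic form. Hence Gauss-Jordan
  elimination succeeds, and \<open>inv_mat\<close> is a genuine inverse and not
  \<open>the None\<close>.\<close>

lemma pos_def_mat_inverse:
  assumes "pos_def_mat S" and S: "S \<in> carrier_mat n n"
  shows "inv_mat S \<in> carrier_mat n n" "S * inv_mat S = 1\<^sub>m n" "inv_mat S * S = 1\<^sub>m n"
proof -
  have "det S \<noteq> 0"
  proof
    assume "det S = 0"
    then obtain v where "v \<in> carrier_vec n" "v \<noteq> 0\<^sub>v n" "S *\<^sub>v v = 0\<^sub>v n"
      using det_0_iff_vec_prod_zero_field[OF S] by auto
    with pos_def_matD(2)[OF assms, of v] show False by simp
  qed
  \<comment> \<open>The argument \<open>()\<close> fills the extension field of the record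
    \<open>ring_mat\<close>, in whose unit group invertibility is expressed.\<close>
  hence "mat_inverse S \<noteq> None"
    using mat_inverse(1)[OF S, of "()"] det_non_zero_imp_unit[OF S, of "()"] by blast
  then obtain B where "mat_inverse S = Some B" by blast
  with mat_inverse(2)[OF S this]
  show "inv_mat S \<in> carrier_mat n n" "S * inv_mat S = 1\<^sub>m n" "inv_mat S * S = 1\<^sub>m n"
    by (auto simp: inv_mat_def)
qed

lemma pos_def_mat_inverse_vec:
  assumes "pos_def_mat S" and S: "S \<in> carrier_mat n n" and v: "v \<in> carrier_vec n"
  shows "inv_mat S *\<^sub>v v \<in> carrier_vec n" "S *\<^sub>v (inv_mat S *\<^sub>v v) = v" "inv_mat S *\<^sub>v (S *\<^sub>v v) = v"
proof -
  note inv = pos_def_mat_inverse[OF assms(1) S]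
  show "inv_mat S *\<^sub>v v \<in> carrier_vec n" using inv(1) v by simp
  show "S *\<^sub>v (inv_mat S *\<^sub>v v) = v" "inv_mat S *\<^sub>v (S *\<^sub>v v) = v"
    using assoc_mult_mat_vec[OF S inv(1) v] assoc_mult_mat_vec[OF inv(1) S v] inv(2,3) v by simp_all
qed

text \<open>Writing \<open>v\<close> as \<open>S\<close> applied to
  \<open>inv_mat S *\<^sub>v v\<close> moves the question from the inverse to \<open>S\<close>,
  which is symmetric by assumption. The same substitution yields the sign of the form in the next
  lemma.\<close>

lemma pos_def_mat_inverse_form_sym:
  assumes "pos_def_mat S" and S: "S \<in> carrier_mat n n" and v: "v \<in> carrier_vec n" "w \<in> carrier_vec n"
  shows "v \<bullet> (inv_mat S *\<^sub>v w) = w \<bullet> (inv_mat S *\<^sub>v v)"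
proof -
  note inv = pos_def_mat_inverse_vec[OF assms(1) S]
  have "v \<bullet> (inv_mat S *\<^sub>v w) = (S *\<^sub>v (inv_mat S *\<^sub>v v)) \<bullet> (inv_mat S *\<^sub>v w)"
    using inv v by simp
  also have "\<dots> = (inv_mat S *\<^sub>v v) \<bullet> (S *\<^sub>v (inv_mat S *\<^sub>v w))"
    using transpose_vec_mult_scalar[OF S inv(1)[OF v(2)] inv(1)[OF v(1)]] pos_def_matD(1)[OF assms(1) S]
    by simp
  also have "\<dots> = w \<bullet> (inv_mat S *\<^sub>v v)"
    using inv v by (simp add: comm_scalar_prod[of _ n])
  finally show ?thesis .
qed

lemma pos_def_mat_inverse_form_nonneg:
  assumes "pos_def_mat S" and S: "S \<in> carrier_mat n n" and v: "v \<in> carrier_vec n"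
  shows "0 \<le> v \<bullet> (inv_mat S *\<^sub>v v)"
proof -
  note inv = pos_def_mat_inverse_vec[OF assms]
  show ?thesis
  proof (cases "inv_mat S *\<^sub>v v = 0\<^sub>v n")
    case True
    thus ?thesis using v by simp
  next
    case False
    from pos_def_matD(2)[OF assms(1) S inv(1) this] show ?thesis
      using inv v by (simp add: comm_scalar_prod[of _ n])
  qed
qed

text \<open>The border is an arbitrary vector so that two families are covered:
  \<open>Sigma_joint\<close>, with a constant border, and the step of \<open>Sigma_claims\<close>
  from one size to the next.\<close>

definition bordered :: "real vec \<Rightarrow> real mat \<Rightarrow> real mat" where
  "bordered r S = four_block_mat (1\<^sub>m 1) (Matrix.mat 1 (dim_vec r) (\<lambda>(_, j). r $ j))
     (Matrix.mat (dim_vec r) 1 (\<lambda>(i, _). r $ i)) S"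

lemma bordered_carrier:
  "r \<in> carrier_vec n \<Longrightarrow> S \<in> carrier_mat n n \<Longrightarrow> bordered r S \<in> carrier_mat (Suc n) (Suc n)"
  by (auto simp: bordered_def)

lemma bordered_mult_vec:
  assumes r: "r \<in> carrier_vec n" and S: "S \<in> carrier_mat n n" and q: "q \<in> carrier_vec n"
  shows "bordered r S *\<^sub>v (Matrix.vec 1 (\<lambda>_. a) @\<^sub>v q)
    = Matrix.vec 1 (\<lambda>_. a + r \<bullet> q) @\<^sub>v (a \<cdot>\<^sub>v r + S *\<^sub>v q)"
proof -
  have "1\<^sub>m 1 *\<^sub>v Matrix.vec 1 (\<lambda>_. a) + Matrix.mat 1 n (\<lambda>(_, j). r $ j) *\<^sub>v q
      = Matrix.vec 1 (\<lambda>_. a + r \<bullet> q)"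
    using r q by (intro eq_vecI) (auto simp: scalar_prod_def)
  moreover have "Matrix.mat n 1 (\<lambda>(i, _). r $ i) *\<^sub>v Matrix.vec 1 (\<lambda>_. a) = a \<cdot>\<^sub>v r"
    using r by (intro eq_vecI) (auto simp: scalar_prod_def)
  ultimately show ?thesis
    using r S q unfolding bordered_def
    by (subst four_block_mat_mult_vec[of _ 1 1 _ n _ n]) auto
qed

lemma scalar_prod_vec1_append:
  assumes "v \<in> carrier_vec n" "w \<in> carrier_vec n"
  shows "(Matrix.vec 1 (\<lambda>_. a) @\<^sub>v v) \<bullet> (Matrix.vec 1 (\<lambda>_. b) @\<^sub>v w) = a * b + v \<bullet> w"
  using assms by (subst scalar_prod_append[of _ 1 _ n]) (auto simp: scalar_prod_def)

lemma vec1_append_carrier: "v \<in> carrier_vec n \<Longrightarrow> Matrix.vec 1 f @\<^sub>v v \<in> carrier_vec (Suc n)"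
  using append_carrier_vec[of "Matrix.vec 1 f" 1 v n] by simp

text \<open>The square of the first factor of \<open>sigma_star\<close>, when \<open>r\<close> is
  the border of the joint matrix.\<close>

definition schur_complement :: "real vec \<Rightarrow> real mat \<Rightarrow> real" where
  "schur_complement r S = 1 - r \<bullet> (inv_mat S *\<^sub>v r)"

lemma schur_complement_pos:
  assumes r: "r \<in> carrier_vec n" and S: "S \<in> carrier_mat n n"
    and pd: "pos_def_mat S" "pos_def_mat (bordered r S)"
  shows "0 < schur_complement r S"
proof -
  note inv = pos_def_mat_inverse_vec[OF pd(1) S r]
  \<comment> \<open>Among the vectors with first entry 1 this one minimises the bordered quadratic
    form, and the minimum is the Schur complement.\<close>
  let ?v = "Matrix.vec 1 (\<lambda>_. 1) @\<^sub>v (- (inv_mat S *\<^sub>v r))"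
  have "?v \<noteq> 0\<^sub>v (Suc n)"
  proof
    assume "?v = 0\<^sub>v (Suc n)"
    hence "?v $ 0 = 0\<^sub>v (Suc n) $ 0" by simp
    thus False by simp
  qed
  moreover have "?v \<in> carrier_vec (Suc n)"
    using inv(1) by (intro vec1_append_carrier) simp
  ultimately have pos: "0 < ?v \<bullet> (bordered r S *\<^sub>v ?v)"
    using pos_def_matD(2)[OF pd(2) bordered_carrier[OF r S]] by blast
  have Sv: "S *\<^sub>v (- (inv_mat S *\<^sub>v r)) = - r"
  proof -
    have "S *\<^sub>v (- (inv_mat S *\<^sub>v r)) = S *\<^sub>v ((-1) \<cdot>\<^sub>v (inv_mat S *\<^sub>v r))"
      by (intro arg_cong[where f = "\<lambda>x. S *\<^sub>v x"] eq_vecI) auto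
    also have "\<dots> = (-1) \<cdot>\<^sub>v r"
      using inv by (subst mult_mat_vec[OF S]) auto
    also have "\<dots> = - r" by (intro eq_vecI) auto
    finally show ?thesis .
  qed
  have "r \<bullet> - (inv_mat S *\<^sub>v r) = - (r \<bullet> (inv_mat S *\<^sub>v r))"
    using r inv(1) by (intro scalar_prod_uminus_right) (metis carrier_vecD)
  hence "?v \<bullet> (bordered r S *\<^sub>v ?v) = schur_complement r S"
    using Sv inv r S
    by (subst bordered_mult_vec[OF r S]) (auto simp: scalar_prod_vec1_append[of _ n, simplified] schur_complement_def)
  with pos show ?thesis by simp
qed

text \<open>Block elimination: the bordered matrix is an upper block triangular matrix with diagonal
  blocks \<open>schur_complement r S\<close> and \<open>S\<close>, times a lower block triangular
  one with identity blocks on the diagonal and the column \<open>inv_mat S *\<^sub>v r\<close>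
  below.\<close>

lemma det_bordered:
  assumes r: "r \<in> carrier_vec n" and S: "S \<in> carrier_mat n n" and pd: "pos_def_mat S"
  shows "det (bordered r S) = schur_complement r S * det S"
proof -
  note inv = pos_def_mat_inverse_vec[OF pd S r]
  let ?R = "Matrix.mat 1 n (\<lambda>(_, j). r $ j)" and ?C = "Matrix.mat n 1 (\<lambda>(i, _). r $ i)"
  let ?b = "Matrix.mat n 1 (\<lambda>(i, _). (inv_mat S *\<^sub>v r) $ i)"
  let ?s = "Matrix.mat 1 1 (\<lambda>_. schur_complement r S)"
  have Sb: "S * ?b = ?C"
  proof (intro eq_matI)
    fix i j assume ij: "i < dim_row ?C" "j < dim_col ?C"
    have "col ?b j = inv_mat S *\<^sub>v r"
      using ij inv(1) by (intro eq_vecI) (auto simp del: index_mult_mat_vec dim_mult_mat_vec)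
    hence "(S * ?b) $$ (i, j) = (S *\<^sub>v (inv_mat S *\<^sub>v r)) $ i" using ij S by simp
    also have "\<dots> = ?C $$ (i, j)" unfolding inv(2) using ij by simp
    finally show "(S * ?b) $$ (i, j) = ?C $$ (i, j)" .
  qed (use S in auto)
  have Rb: "?s + ?R * ?b = 1\<^sub>m 1"
    using r inv(1)
    by (intro eq_matI)
       (auto simp: schur_complement_def scalar_prod_def simp del: index_mult_mat_vec dim_mult_mat_vec)
  have "four_block_mat ?s ?R (0\<^sub>m n 1) S * four_block_mat (1\<^sub>m 1) (0\<^sub>m 1 n) ?b (1\<^sub>m n)
      = four_block_mat (?s * 1\<^sub>m 1 + ?R * ?b) (?s * 0\<^sub>m 1 n + ?R * 1\<^sub>m n)
          (0\<^sub>m n 1 * 1\<^sub>m 1 + S * ?b) (0\<^sub>m n 1 * 0\<^sub>m 1 n + S * 1\<^sub>m n)"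
    using S by (intro mult_four_block_mat) auto
  also have "\<dots> = bordered r S"
    unfolding bordered_def
  proof (intro cong_four_block_mat)
    show "?s * 1\<^sub>m 1 + ?R * ?b = 1\<^sub>m 1" using Rb by simp
    show "0\<^sub>m n 1 * 1\<^sub>m 1 + S * ?b = Matrix.mat (dim_vec r) 1 (\<lambda>(i, _). r $ i)"
      using Sb r left_add_zero_mat[of ?C n 1] by simp
  qed (use r S in auto)
  finally have "det (bordered r S) = det (four_block_mat ?s ?R (0\<^sub>m n 1) S * four_block_mat (1\<^sub>m 1) (0\<^sub>m 1 n) ?b (1\<^sub>m n))"
    by simp
  also have "\<dots> = det (four_block_mat ?s ?R (0\<^sub>m n 1) S) * det (four_block_mat (1\<^sub>m 1) (0\<^sub>m 1 n) ?b (1\<^sub>m n))"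
    using S by (intro det_mult[of _ "1 + n"]) auto
  also have "det (four_block_mat ?s ?R (0\<^sub>m n 1) S) = det ?s * det S"
    using S by (intro det_four_block_mat_lower_left_zero) auto
  also have "det (four_block_mat (1\<^sub>m 1) (0\<^sub>m 1 n) ?b (1\<^sub>m n)) = det (1\<^sub>m 1 :: real mat) * det (1\<^sub>m n :: real mat)"
    by (intro det_four_block_mat_upper_right_zero) auto
  also have "det ?s = schur_complement r S"
    by (subst det_single) auto
  finally show ?thesis by simp
qed

text \<open>The inverse is read off from the solution of the bordered linear system.\<close>

lemma bordered_inverse_form:
  assumes r: "r \<in> carrier_vec n" and S: "S \<in> carrier_mat n n" and q: "q \<in> carrier_vec n"
    and pd: "pos_def_mat S" "pos_def_mat (bordered r S)"
  shows "(Matrix.vec 1 (\<lambda>_. a) @\<^sub>v q) \<bullet> (inv_mat (bordered r S) *\<^sub>v (Matrix.vec 1 (\<lambda>_. a) @\<^sub>v q))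
    = q \<bullet> (inv_mat S *\<^sub>v q) + (a - r \<bullet> (inv_mat S *\<^sub>v q))\<^sup>2 / schur_complement r S"
proof -
  define s where "s = schur_complement r S"
  define \<mu> where "\<mu> = r \<bullet> (inv_mat S *\<^sub>v q)"
  \<comment> \<open>Block elimination in the system with right-hand side \<open>a\<close>,
    \<open>q\<close>: solving the lower block for \<open>w\<close> and inserting it into the scalar
    equation \<open>w0 + r \<bullet> w = a\<close> leaves \<open>s * w0 = a - \<mu>\<close>.\<close>
  define w0 where "w0 = (a - \<mu>) / s"
  define w where "w = inv_mat S *\<^sub>v q - w0 \<cdot>\<^sub>v (inv_mat S *\<^sub>v r)"
  let ?W = "Matrix.vec 1 (\<lambda>_. w0) @\<^sub>v w"
  note B = bordered_carrier[OF r S]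
  have s: "s > 0" unfolding s_def by (rule schur_complement_pos[OF r S pd])
  note invr = pos_def_mat_inverse_vec[OF pd(1) S r] and invq = pos_def_mat_inverse_vec[OF pd(1) S q]
  have w: "w \<in> carrier_vec n" unfolding w_def using invr invq by simp
  have "S *\<^sub>v w = q - w0 \<cdot>\<^sub>v r"
    unfolding w_def using invr invq
    by (subst mult_minus_distrib_mat_vec[OF S]) (auto simp: mult_mat_vec[OF S])
  hence 1: "w0 \<cdot>\<^sub>v r + S *\<^sub>v w = q" using r q by (intro eq_vecI) auto
  have "r \<bullet> w = \<mu> - w0 * (1 - s)"
    unfolding w_def \<mu>_def s_def schur_complement_def using r invr invq
    by (subst scalar_prod_minus_distrib[of _ n]) (auto)
  hence 2: "w0 + r \<bullet> w = a" using s by (simp add: w0_def field_simps)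
  have "bordered r S *\<^sub>v ?W = Matrix.vec 1 (\<lambda>_. a) @\<^sub>v q"
    by (subst bordered_mult_vec[OF r S w]) (simp add: 1 2)
  moreover have "?W \<in> carrier_vec (Suc n)" using w by (rule vec1_append_carrier)
  ultimately have "inv_mat (bordered r S) *\<^sub>v (Matrix.vec 1 (\<lambda>_. a) @\<^sub>v q) = ?W"
    using pos_def_mat_inverse_vec(3)[OF pd(2) B, of ?W] by simp
  hence "(Matrix.vec 1 (\<lambda>_. a) @\<^sub>v q) \<bullet> (inv_mat (bordered r S) *\<^sub>v (Matrix.vec 1 (\<lambda>_. a) @\<^sub>v q))
      = a * w0 + q \<bullet> w"
    using q w by (simp add: scalar_prod_vec1_append[simplified])
  also have "q \<bullet> w = q \<bullet> (inv_mat S *\<^sub>v q) - w0 * \<mu>"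
    unfolding w_def \<mu>_def using q invr invq pos_def_mat_inverse_form_sym[OF pd(1) S r q]
    by (subst scalar_prod_minus_distrib[of _ n]) auto
  also have "a * w0 + (q \<bullet> (inv_mat S *\<^sub>v q) - w0 * \<mu>) = q \<bullet> (inv_mat S *\<^sub>v q) + (a - \<mu>)\<^sup>2 / s"
    by (simp add: w0_def power2_eq_square algebra_simps diff_divide_distrib add_divide_distrib)
  finally show ?thesis unfolding \<mu>_def s_def .
qed

section \<open>The scale matrices of the model as bordered matrices\<close>

lemma Sigma_joint_bordered: "Sigma_joint \<rho>1 \<rho>2 k z = bordered (\<rho>1 \<cdot>\<^sub>v ones_vec k) (Sigma_claims \<rho>2 k z)"
proof -
  have "Matrix.mat 1 k (\<lambda>_. \<rho>1) = Matrix.mat 1 k (\<lambda>(_, j). (\<rho>1 \<cdot>\<^sub>v ones_vec k) $ j)"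
    "Matrix.mat k 1 (\<lambda>_. \<rho>1) = Matrix.mat k 1 (\<lambda>(i, _). (\<rho>1 \<cdot>\<^sub>v ones_vec k) $ i)"
    by (intro eq_matI; simp add: ones_vec_def)+
  thus ?thesis by (simp add: Sigma_joint_def bordered_def ones_vec_def)
qed

lemma Sigma_claims_carrier: "Sigma_claims \<rho> k z \<in> carrier_mat k k"
  by (simp add: Sigma_claims_def)

text \<open>The new coordinate goes in front. Deleting the first row and column preserves
  equicorrelation, and it preserves the power structure because entries there depend only on the
  difference of the indices. This is what makes induction on the size possible.\<close>

lemma Sigma_claims_Suc:
  "Sigma_claims \<rho> (Suc k) z
    = bordered (Matrix.vec k (\<lambda>i. if z = 1 then \<rho> else \<rho> ^ Suc i)) (Sigma_claims \<rho> k z)"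
proof (intro eq_matI)
  fix i j assume "i < dim_row (bordered (Matrix.vec k (\<lambda>i. if z = 1 then \<rho> else \<rho> ^ Suc i)) (Sigma_claims \<rho> k z))"
    "j < dim_col (bordered (Matrix.vec k (\<lambda>i. if z = 1 then \<rho> else \<rho> ^ Suc i)) (Sigma_claims \<rho> k z))"
  hence "i < Suc k" "j < Suc k" by (auto simp: bordered_def Sigma_claims_def)
  thus "Sigma_claims \<rho> (Suc k) z $$ (i, j)
    = bordered (Matrix.vec k (\<lambda>i. if z = 1 then \<rho> else \<rho> ^ Suc i)) (Sigma_claims \<rho> k z) $$ (i, j)"
    by (cases i; cases j) (auto simp: bordered_def Sigma_claims_def nat_add_distrib)
qed (auto simp: bordered_def Sigma_claims_def)

lemma pos_def_Sigma_claims_0: "pos_def_mat (Sigma_claims \<rho> 0 z)"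
  by (auto simp: pos_def_mat_def Sigma_claims_def)

text \<open>The determinant is a product of Schur complements, one for each step of the size,
  starting from the empty determinant 1.\<close>

lemma det_Sigma_claims_pos:
  assumes "\<And>k. k \<ge> 1 \<Longrightarrow> pos_def_mat (Sigma_claims \<rho> k z)"
  shows "det (Sigma_claims \<rho> k z) > 0"
proof (induction k)
  case 0
  show ?case by (simp add: det_dim_zero[OF Sigma_claims_carrier])
next
  case (Suc k)
  have pd: "pos_def_mat (Sigma_claims \<rho> k z)"
    using assms[of k] pos_def_Sigma_claims_0 by (cases k) auto
  show ?case
    using Suc schur_complement_pos[OF _ Sigma_claims_carrier pd] assms[of "Suc k"] 
    unfolding Sigma_claims_Suc by (subst det_bordered[OF _ Sigma_claims_carrier pd]) auto
qed

section \<open>Conditioning the multivariate t-distribution on all but one coordinate\<close>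

text \<open>This function and \<open>cond_scale\<close> below are \<open>mu_star\<close> and
  \<open>sigma_star\<close> before the quantiles of the claims are substituted: location and scale
  of the front coordinate, given that the others are \<open>x\<close>.\<close>

definition cond_mean :: "nat \<Rightarrow> real vec \<Rightarrow> real mat \<Rightarrow> (nat \<Rightarrow> real) \<Rightarrow> real" where
  "cond_mean n r S x = r \<bullet> (inv_mat S *\<^sub>v Matrix.vec n x)"

definition quad_form :: "nat \<Rightarrow> real mat \<Rightarrow> (nat \<Rightarrow> real) \<Rightarrow> real" where
  "quad_form n S x = Matrix.vec n x \<bullet> (inv_mat S *\<^sub>v Matrix.vec n x)"

definition cond_scale :: "real \<Rightarrow> nat \<Rightarrow> real vec \<Rightarrow> real mat \<Rightarrow> (nat \<Rightarrow> real) \<Rightarrow> real" where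
  "cond_scale df n r S x = sqrt (schur_complement r S) * sqrt ((df + quad_form n S x) / (df + real n))"

lemma quad_form_nonneg: "pos_def_mat S \<Longrightarrow> S \<in> carrier_mat n n \<Longrightarrow> 0 \<le> quad_form n S x"
  unfolding quad_form_def by (rule pos_def_mat_inverse_form_nonneg) auto

lemma mvt_density_alt:
  assumes "S \<in> carrier_mat n n"
  shows "mvt_density df S x = Gamma ((real n + df) / 2)
        / (Gamma (df / 2) * (pi * df) powr (real n / 2) * sqrt (det S))
        * (1 + quad_form n S x / df) powr (- ((real n + df) / 2))"
  using assms by (simp add: mvt_density_def Let_def quad_form_def minus_divide_left)

lemma mvt_density_nonneg:
  assumes "S \<in> carrier_mat n n" "df > 0" "det S > 0"
  shows "0 \<le> mvt_density df S x"
  unfolding mvt_density_alt[OF assms(1)] using assms(2,3)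
  by (intro mult_nonneg_nonneg divide_nonneg_nonneg less_imp_le[OF Gamma_real_pos]) auto

context
  fixes n :: nat and r :: "real vec" and S :: "real mat" and df :: real
  assumes r: "r \<in> carrier_vec n" and S: "S \<in> carrier_mat n n"
    and pd: "pos_def_mat S" "pos_def_mat (bordered r S)" and det: "det S > 0" and df: "df > 0"
begin

lemma cond_scale_pos: "0 < cond_scale df n r S x"
  unfolding cond_scale_def using schur_complement_pos[OF r S pd] quad_form_nonneg[OF pd(1) S] df
  by (intro mult_pos_pos real_sqrt_gt_zero divide_pos_pos) (auto intro: add_pos_nonneg)

text \<open>The quadratic form splits as a sum, but the density is a power of one plus the form, so
  the sum has to become a product \<open>A * B\<close> of a marginal and a conditional factor. This
  forces \<open>\<sigma>\<^sup>2 * (df + real n)\<close> to equal \<open>s * (df + Q)\<close>, the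
  origin of the second square root in \<open>sigma_star\<close> and of the raised degrees of
  freedom. Of the power of \<open>A\<close>, the part with exponent \<open>- (m / 2)\<close> belongs
  to the marginal density, and the remaining \<open>1 / sqrt A\<close> is absorbed by
  \<open>1 / \<sigma>\<close>.\<close>

lemma mvt_density_bordered:
  "mvt_density df (bordered r S) (case_nat x0 x) =
     mvt_density df S x *
       (student_density (df + real n) ((x0 - cond_mean n r S x) / cond_scale df n r S x) / cond_scale df n r S x)"
proof -
  define s where "s = schur_complement r S"
  define Q where "Q = quad_form n S x"
  define \<mu> where "\<mu> = cond_mean n r S x"
  define \<sigma> where "\<sigma> = cond_scale df n r S x"
  define A where "A = 1 + Q / df"
  define B where "B = 1 + ((x0 - \<mu>) / \<sigma>)\<^sup>2 / (df + real n)"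
  define m where "m = real n + df"
  have s: "s > 0" unfolding s_def by (rule schur_complement_pos[OF r S pd])
  have Q: "Q \<ge> 0" unfolding Q_def by (rule quad_form_nonneg[OF pd(1) S])
  have m: "m > 0" using df by (simp add: m_def)
  have A: "A > 0" using Q df by (auto simp: A_def intro: add_pos_nonneg)
  have B: "B > 0" using df by (auto simp: B_def intro: add_pos_nonneg)
  have \<sigma>: "\<sigma> = sqrt (s * df * A / m)"
  proof -
    have "(df + Q) / (df + real n) = df * A / m"
      using df by (simp add: A_def m_def distrib_left add.commute)
    thus ?thesis
      by (simp add: \<sigma>_def cond_scale_def s_def[symmetric] Q_def[symmetric] real_sqrt_mult[symmetric] mult.assoc)
  qed
  have \<sigma>2: "\<sigma>\<^sup>2 = s * df * A / m" using s df A m by (simp add: \<sigma>)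
  have "Matrix.vec (Suc n) (case_nat x0 x) = Matrix.vec 1 (\<lambda>_. x0) @\<^sub>v Matrix.vec n x"
    by (intro eq_vecI) (auto split: nat.split)
  hence qf: "quad_form (Suc n) (bordered r S) (case_nat x0 x) = Q + (x0 - \<mu>)\<^sup>2 / s"
    unfolding quad_form_def Q_def \<mu>_def s_def cond_mean_def
    by (simp only: bordered_inverse_form[OF r S _ pd] vec_carrier)
  have "A * B = A + A * (x0 - \<mu>)\<^sup>2 / (\<sigma>\<^sup>2 * m)"
    by (simp add: B_def m_def power_divide algebra_simps)
  also have "A * (x0 - \<mu>)\<^sup>2 / (\<sigma>\<^sup>2 * m) = (x0 - \<mu>)\<^sup>2 / s / df"
    using A s df m by (simp add: \<sigma>2)
  finally have AB: "1 + (Q + (x0 - \<mu>)\<^sup>2 / s) / df = A * B"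
    by (simp add: A_def add_divide_distrib)
  have e: "- ((m + 1) / 2) = - (m / 2) - 1/2" "(df + real n + 1) / 2 = (m + 1) / 2"
    "- (df + real n + 1) / 2 = - (m / 2) - 1/2" "(real (Suc n) + df) / 2 = (m + 1) / 2"
    by (simp_all add: m_def field_simps)
  have pw: "(A * B) powr (- (m / 2) - 1/2) = A powr (- (m / 2)) / sqrt A * B powr (- (m / 2) - 1/2)"
    using A B by (subst powr_mult) (simp_all add: powr_diff powr_half_sqrt)
  have pp: "(pi * df) powr (real (Suc n) / 2) = (pi * df) powr (real n / 2) * sqrt (pi * df)"
    using df by (simp add: powr_half_sqrt[symmetric] powr_add[symmetric] add_divide_distrib add.commute)
  have dt: "sqrt (det (bordered r S)) = sqrt s * sqrt (det S)"
    by (simp add: det_bordered[OF r S pd(1)] s_def real_sqrt_mult)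
  \<comment> \<open>\<open>Gamma (m / 2)\<close> is a numerator in the marginal constant and a
    denominator in the Student constant, so it cancels in the product.\<close>
  have G: "Gamma (m / 2) \<noteq> 0" "Gamma (df / 2) \<noteq> 0"
    using Gamma_real_pos[of "m / 2"] Gamma_real_pos[of "df / 2"] m df by linarith+
  have L: "mvt_density df (bordered r S) (case_nat x0 x) = Gamma ((m + 1) / 2)
      / (Gamma (df / 2) * ((pi * df) powr (real n / 2) * sqrt (pi * df)) * (sqrt s * sqrt (det S)))
      * (A powr (- (m / 2)) / sqrt A * B powr (- (m / 2) - 1/2))"
    unfolding mvt_density_alt[OF bordered_carrier[OF r S]] qf AB e pw pp dt ..
  have R1: "mvt_density df S x = Gamma (m / 2) / (Gamma (df / 2) * (pi * df) powr (real n / 2) * sqrt (det S))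
      * A powr (- (m / 2))"
    unfolding mvt_density_alt[OF S] A_def Q_def m_def ..
  have R2: "student_density (df + real n) ((x0 - \<mu>) / \<sigma>) = Gamma ((m + 1) / 2) / (Gamma (m / 2) * sqrt (m * pi))
      * B powr (- (m / 2) - 1/2)"
    unfolding student_density_def e B_def by (simp add: m_def add.commute)
  have "sqrt (m * pi) * \<sigma> = sqrt (pi * df) * sqrt s * sqrt A"
    using m by (simp add: \<sigma> real_sqrt_mult[symmetric] mult_ac)
  hence sq: "Gamma (m / 2) * sqrt (m * pi) * \<sigma> = Gamma (m / 2) * (sqrt (pi * df) * sqrt s * sqrt A)"
    by (simp add: mult.assoc)
  have "student_density (df + real n) ((x0 - \<mu>) / \<sigma>) / \<sigma> = Gamma ((m + 1) / 2) / (Gamma (m / 2) * sqrt (m * pi) * \<sigma>)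
      * B powr (- (m / 2) - 1/2)"
    unfolding R2 by simp
  also have "\<dots> = Gamma ((m + 1) / 2) / (Gamma (m / 2) * (sqrt (pi * df) * sqrt s * sqrt A))
      * B powr (- (m / 2) - 1/2)"
    unfolding sq ..
  finally show ?thesis
    unfolding L R1 \<mu>_def[symmetric] \<sigma>_def[symmetric] using G by (simp add: mult_ac)
qed

end

text \<open>Substitution of \<open>\<mu> + \<sigma> * w\<close>. The bound is an extended real
  because quantiles can be infinite; in the model this happens for the lower bound at count 1, where
  \<open>F1\<close> is taken at 0.\<close>

lemma nn_integral_student_density_scaled:
  assumes \<nu>: "\<nu> > 0" and \<sigma>: "\<sigma> > 0"
  shows "(\<integral>\<^sup>+x. ennreal (student_density \<nu> ((x - \<mu>) / \<sigma>) / \<sigma>) * indicator {x. ereal x \<le> a} x \<partial>lborel)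
    = ennreal (t_cdf \<nu> ((a - ereal \<mu>) / ereal \<sigma>))"
proof -
  interpret real_distribution "student_t \<nu>" by (rule real_distribution_student_t) fact
  have iff: "ereal (\<mu> + \<sigma> * w) \<le> a \<longleftrightarrow> ereal w \<le> (a - ereal \<mu>) / ereal \<sigma>" for w
    using \<sigma> by (cases a) (auto simp: field_simps)
  have "(\<integral>\<^sup>+x. ennreal (student_density \<nu> ((x - \<mu>) / \<sigma>) / \<sigma>) * indicator {x. ereal x \<le> a} x \<partial>lborel)
    = ennreal \<sigma> * (\<integral>\<^sup>+w. ennreal (student_density \<nu> ((\<mu> + \<sigma> * w - \<mu>) / \<sigma>) / \<sigma>) * indicator {x. ereal x \<le> a} (\<mu> + \<sigma> * w) \<partial>lborel)"
    using \<sigma> by (subst nn_integral_real_affine[where c = \<sigma> and t = \<mu>]) auto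
  also have "\<dots> = (\<integral>\<^sup>+w. ennreal \<sigma> * (ennreal (student_density \<nu> ((\<mu> + \<sigma> * w - \<mu>) / \<sigma>) / \<sigma>) * indicator {x. ereal x \<le> a} (\<mu> + \<sigma> * w)) \<partial>lborel)"
    by (intro nn_integral_cmult[symmetric]) measurable
  also have "\<dots> = (\<integral>\<^sup>+w. ennreal (student_density \<nu> w) * indicator {w. ereal w \<le> (a - ereal \<mu>) / ereal \<sigma>} w \<partial>lborel)"
  proof (intro nn_integral_cong)
    fix w
    have "ennreal \<sigma> * ennreal (student_density \<nu> w / \<sigma>) = ennreal (student_density \<nu> w)"
      using \<sigma> by (simp flip: ennreal_mult')
    thus "ennreal \<sigma> * (ennreal (student_density \<nu> ((\<mu> + \<sigma> * w - \<mu>) / \<sigma>) / \<sigma>) * indicator {x. ereal x \<le> a} (\<mu> + \<sigma> * w))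
      = ennreal (student_density \<nu> w) * indicator {w. ereal w \<le> (a - ereal \<mu>) / ereal \<sigma>} w"
      using \<sigma> by (simp add: indicator_def iff)
  qed
  also have "\<dots> = emeasure (student_t \<nu>) {w. ereal w \<le> (a - ereal \<mu>) / ereal \<sigma>}"
    unfolding student_t_alt by (intro emeasure_density[symmetric]) auto
  also have "\<dots> = ennreal (t_cdf \<nu> ((a - ereal \<mu>) / ereal \<sigma>))"
    by (simp add: t_cdf_def emeasure_eq_measure)
  finally show ?thesis .
qed

section \<open>Measurability, through finite sums of coordinate projections\<close>

lemma mat_vec_scalar_prod_sum:
  assumes "B \<in> carrier_mat n n" "v \<in> carrier_vec n"
  shows "v \<bullet> (B *\<^sub>v Matrix.vec n x) = (\<Sum>i<n. v $ i * (\<Sum>j<n. B $$ (i, j) * x j))"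
  using assms by (auto simp: scalar_prod_def atLeast0LessThan intro!: sum.cong)

lemma cond_mean_measurable:
  assumes "pos_def_mat S" "S \<in> carrier_mat n n" "r \<in> carrier_vec n"
  shows "cond_mean n r S \<in> borel_measurable (PiM {..<n} (\<lambda>_. borel))"
proof -
  have "cond_mean n r S = (\<lambda>x. \<Sum>i<n. r $ i * (\<Sum>j<n. inv_mat S $$ (i, j) * x j))"
    using mat_vec_scalar_prod_sum[OF pos_def_mat_inverse(1)[OF assms(1,2)] assms(3)]
    by (intro ext) (simp add: cond_mean_def)
  thus ?thesis by simp
qed

lemma quad_form_measurable:
  assumes "pos_def_mat S" "S \<in> carrier_mat n n"
  shows "quad_form n S \<in> borel_measurable (PiM {..<n} (\<lambda>_. borel))"
proof -
  have "quad_form n S = (\<lambda>x. \<Sum>i<n. x i * (\<Sum>j<n. inv_mat S $$ (i, j) * x j))"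
    using mat_vec_scalar_prod_sum[OF pos_def_mat_inverse(1)[OF assms]]
    by (intro ext) (simp add: quad_form_def)
  thus ?thesis by simp
qed

lemma cond_scale_measurable:
  assumes "pos_def_mat S" "S \<in> carrier_mat n n"
  shows "cond_scale df n r S \<in> borel_measurable (PiM {..<n} (\<lambda>_. borel))"
  using quad_form_measurable[OF assms] unfolding cond_scale_def by measurable

lemma mvt_density_measurable:
  assumes "pos_def_mat S" "S \<in> carrier_mat n n"
  shows "mvt_density df S \<in> borel_measurable (PiM {..<n} (\<lambda>_. borel))"
  using quad_form_measurable[OF assms] unfolding mvt_density_alt[OF assms(2), abs_def] by measurable

text \<open>On finite arguments \<open>t_cdf\<close> is a continuous function; the two infinite
  arguments are measurable points with the values 0 and 1.\<close>

lemma borel_measurable_t_cdf_standardized: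
  assumes \<nu>: "\<nu> > 0" and [measurable]: "f \<in> borel_measurable M" "g \<in> borel_measurable M"
  shows "(\<lambda>x. t_cdf \<nu> ((a - ereal (f x)) / ereal (g x))) \<in> borel_measurable M"
proof -
  interpret real_distribution "student_t \<nu>" by (rule real_distribution_student_t) fact
  have [measurable]: "cdf (student_t \<nu>) \<in> borel_measurable borel"
    by (rule borel_measurable_continuous_onI[OF continuous_cdf_student_t[OF \<nu>]])
  have "t_cdf \<nu> = (\<lambda>y. if y = \<infinity> then 1 else if y = - \<infinity> then 0 else cdf (student_t \<nu>) (real_of_ereal y))"
  proof
    fix y show "t_cdf \<nu> y = (if y = \<infinity> then 1 else if y = - \<infinity> then 0 else cdf (student_t \<nu>) (real_of_ereal y))"
      using t_cdf_PInf[OF \<nu>] by (cases y) (auto simp: t_cdf_ereal)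
  qed
  hence m: "t_cdf \<nu> \<in> borel_measurable borel" by simp
  show ?thesis by (rule measurable_compose[OF _ m]) measurable
qed

section \<open>Integrating out the front coordinate and total mass\<close>

lemma mvt_eq:
  "S \<in> carrier_mat n n \<Longrightarrow>
    mvt df S = density (PiM {..<n} (\<lambda>_. lborel)) (\<lambda>x. ennreal (mvt_density df S x))"
  by (auto simp: mvt_def)

lemma space_mvt: "S \<in> carrier_mat n n \<Longrightarrow> space (mvt df S) = PiE {..<n} (\<lambda>_. UNIV)"
  by (simp add: mvt_eq space_PiM)

lemma sets_mvt: "S \<in> carrier_mat n n \<Longrightarrow> sets (mvt df S) = sets (PiM {..<n} (\<lambda>_. borel))"
  by (simp add: mvt_eq sets_PiM_lborel)

context
  fixes n :: nat and r :: "real vec" and S :: "real mat" and df :: real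
  assumes r: "r \<in> carrier_vec n" and S: "S \<in> carrier_mat n n"
    and pd: "pos_def_mat S" "pos_def_mat (bordered r S)" and det: "det S > 0" and df: "df > 0"
begin

text \<open>With the other coordinates fixed, the inner integral over the front coordinate is a
  value of \<open>t_cdf\<close>. Extended bounds serve twice: they admit the quantiles at 0 and 1,
  and setting all of them to infinity gives the total mass.\<close>

lemma emeasure_mvt_bordered:
  "emeasure (mvt df (bordered r S))
      {x \<in> PiE {..<Suc n} (\<lambda>_. UNIV). ereal (x 0) \<le> a \<and> (\<forall>i<n. ereal (x (Suc i)) \<le> b i)}
    = (\<integral>\<^sup>+x. ennreal (t_cdf (df + real n)
          ((a - ereal (cond_mean n r S x)) / ereal (cond_scale df n r S x))) *
        indicator {x. \<forall>i<n. ereal (x i) \<le> b i} x \<partial>mvt df S)"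
proof -
  note B = bordered_carrier[OF r S]
  note [measurable] = mvt_density_measurable[OF pd(1) S] mvt_density_measurable[OF pd(2) B]
    cond_mean_measurable[OF pd(1) S r] cond_scale_measurable[OF pd(1) S, of df r]
  have [measurable]: "(\<lambda>x. t_cdf (df + real n) ((a - ereal (cond_mean n r S x)) / ereal (cond_scale df n r S x)))
      \<in> borel_measurable (PiM {..<n} (\<lambda>_. borel))"
    using df by (intro borel_measurable_t_cdf_standardized) (auto)
  define Ob where "Ob = {x \<in> PiE {..<Suc n} (\<lambda>_. UNIV). ereal (x 0) \<le> a \<and> (\<forall>i<n. ereal (x (Suc i)) \<le> b i)}"
  define Os where "Os = {x \<in> PiE {..<n} (\<lambda>_. UNIV). \<forall>i<n. ereal (x i) \<le> b i}"
  have "Ob = {x \<in> space (PiM {..<Suc n} (\<lambda>_. borel)). ereal (x 0) \<le> a \<and> (\<forall>i\<in>{..<n}. ereal (x (Suc i)) \<le> b i)}"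
    by (auto simp: Ob_def space_PiM)
  also have "\<dots> \<in> sets (PiM {..<Suc n} (\<lambda>_. borel))"
    by measurable
  finally have Ob [measurable]: "Ob \<in> sets (PiM {..<Suc n} (\<lambda>_. borel))" .
  have "Os = {x \<in> space (PiM {..<n} (\<lambda>_. borel)). \<forall>i\<in>{..<n}. ereal (x i) \<le> b i}"
    by (auto simp: Os_def space_PiM)
  also have "\<dots> \<in> sets (PiM {..<n} (\<lambda>_. borel))"
    by measurable
  finally have Os [measurable]: "Os \<in> sets (PiM {..<n} (\<lambda>_. borel))" .
  have "emeasure (mvt df (bordered r S)) Ob
    = (\<integral>\<^sup>+x. ennreal (mvt_density df (bordered r S) x) * indicator Ob x \<partial>PiM {..<Suc n} (\<lambda>_. lborel))"
    unfolding mvt_eq[OF B] by (intro emeasure_density) auto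
  also have "\<dots> = (\<integral>\<^sup>+x. \<integral>\<^sup>+x0. ennreal (mvt_density df (bordered r S) (case_nat x0 x)) *
      indicator Ob (case_nat x0 x) \<partial>lborel \<partial>PiM {..<n} (\<lambda>_. lborel))"
    by (rule nn_integral_PiM_lborel_Suc) measurable
  also have "\<dots> = (\<integral>\<^sup>+x. ennreal (mvt_density df S x) * (ennreal (t_cdf (df + real n)
          ((a - ereal (cond_mean n r S x)) / ereal (cond_scale df n r S x))) * indicator Os x) \<partial>PiM {..<n} (\<lambda>_. lborel))"
  proof (intro nn_integral_cong)
    fix x assume "x \<in> space (PiM {..<n} (\<lambda>_. lborel :: real measure))"
    hence x: "x \<in> PiE {..<n} (\<lambda>_. UNIV)" by (simp add: space_PiM)
    have ind: "indicator Ob (case_nat x0 x) = (indicator {x. ereal x \<le> a} x0 * indicator Os x :: ennreal)" for x0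
      using x by (auto simp: Ob_def Os_def indicator_def case_nat_mem_PiE)
    note sc = cond_scale_pos[OF r S pd det df, of x]
    have "(\<integral>\<^sup>+x0. ennreal (mvt_density df (bordered r S) (case_nat x0 x)) * indicator Ob (case_nat x0 x) \<partial>lborel)
      = (\<integral>\<^sup>+x0. (ennreal (mvt_density df S x) * indicator Os x) *
           (ennreal (student_density (df + real n) ((x0 - cond_mean n r S x) / cond_scale df n r S x) / cond_scale df n r S x)
             * indicator {x. ereal x \<le> a} x0) \<partial>lborel)"
      by (intro nn_integral_cong)
         (simp only: mvt_density_bordered[OF r S pd det df] ind
            ennreal_mult'[OF mvt_density_nonneg[OF S df det]] mult_ac)
    also have "\<dots> = (ennreal (mvt_density df S x) * indicator Os x) * ennreal (t_cdf (df + real n)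
          ((a - ereal (cond_mean n r S x)) / ereal (cond_scale df n r S x)))"
      using df sc by (subst nn_integral_cmult) (measurable, simp add: nn_integral_student_density_scaled)
    finally show "(\<integral>\<^sup>+x0. ennreal (mvt_density df (bordered r S) (case_nat x0 x)) * indicator Ob (case_nat x0 x) \<partial>lborel)
      = ennreal (mvt_density df S x) * (ennreal (t_cdf (df + real n)
          ((a - ereal (cond_mean n r S x)) / ereal (cond_scale df n r S x))) * indicator Os x)"
      by (simp add: mult_ac)
  qed
  also have "\<dots> = (\<integral>\<^sup>+x. ennreal (t_cdf (df + real n)
          ((a - ereal (cond_mean n r S x)) / ereal (cond_scale df n r S x))) * indicator Os x \<partial>mvt df S)"
    unfolding mvt_eq[OF S] by (intro nn_integral_density[symmetric]) measurable
  also have "\<dots> = (\<integral>\<^sup>+x. ennreal (t_cdf (df + real n)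
          ((a - ereal (cond_mean n r S x)) / ereal (cond_scale df n r S x))) *
        indicator {x. \<forall>i<n. ereal (x i) \<le> b i} x \<partial>mvt df S)"
    by (intro nn_integral_cong) (auto simp: Os_def indicator_def space_mvt[OF S])
  finally show ?thesis unfolding Ob_def .
qed

text \<open>With infinite bounds the conditional distribution function is 1, so bordering the scale
  matrix leaves the total mass unchanged.\<close>

lemma prob_space_mvt_bordered:
  assumes "prob_space (mvt df S)"
  shows "prob_space (mvt df (bordered r S))"
proof (rule prob_spaceI)
  note B = bordered_carrier[OF r S]
  have "(\<infinity> - ereal (cond_mean n r S x)) / ereal (cond_scale df n r S x) = \<infinity>" for x
    using cond_scale_pos[OF r S pd det df, of x] by simp
  hence "emeasure (mvt df (bordered r S)) {x \<in> PiE {..<Suc n} (\<lambda>_. UNIV). ereal (x 0) \<le> \<infinity> \<and> (\<forall>i<n. ereal (x (Suc i)) \<le> \<infinity>)}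
      = emeasure (mvt df S) (space (mvt df S))"
    using df by (subst emeasure_mvt_bordered[where b = "\<lambda>_. \<infinity>"]) (simp add: t_cdf_PInf)
  also have "\<dots> = 1" using assms by (rule prob_space.emeasure_space_1)
  finally show "emeasure (mvt df (bordered r S)) (space (mvt df (bordered r S))) = 1"
    by (simp add: space_mvt[OF B])
qed

end

text \<open>No diagonalisation of the scale matrix is involved: the mass passes from each size to
  the next, beginning with dimension 0, where the density is 1 on a one-point space.\<close>

lemma prob_space_mvt_Sigma_claims:
  assumes pd: "\<And>k. k \<ge> 1 \<Longrightarrow> pos_def_mat (Sigma_claims \<rho> k z)" and df: "df > 0"
  shows "prob_space (mvt df (Sigma_claims \<rho> k z))"
proof (induction k)
  case 0
  interpret L: product_sigma_finite "\<lambda>_::nat. lborel :: real measure" ..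
  have "Gamma (df / 2) \<noteq> 0" using Gamma_real_pos[of "df / 2"] df by linarith
  hence "mvt_density df (Sigma_claims \<rho> 0 z) x = 1" for x
    using df by (simp add: mvt_density_alt[OF Sigma_claims_carrier] det_dim_zero[OF Sigma_claims_carrier]
      quad_form_def scalar_prod_def)
  hence "emeasure (mvt df (Sigma_claims \<rho> 0 z)) (space (mvt df (Sigma_claims \<rho> 0 z))) = 1"
    by (simp add: mvt_eq[OF Sigma_claims_carrier] emeasure_density space_PiM PiM_empty)
  thus ?case by (rule prob_spaceI)
next
  case (Suc k)
  have "pos_def_mat (Sigma_claims \<rho> k z)"
    using pd[of k] pos_def_Sigma_claims_0 by (cases k) auto
  thus ?case
    using pd[of "Suc k"] Suc df unfolding Sigma_claims_Suc
    by (intro prob_space_mvt_bordered[OF _ Sigma_claims_carrier]) (auto intro: det_Sigma_claims_pos pd)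
qed

section \<open>The density of the t-copula\<close>

abbreviation unif :: "real measure" where
  "unif \<equiv> uniform_measure lborel {0<..<1}"

abbreviation unit_cube :: "nat \<Rightarrow> (nat \<Rightarrow> real) set" where
  "unit_cube n \<equiv> PiE {..<n} (\<lambda>_. {0<..<1})"

lemma prob_space_unif: "prob_space unif"
  by (rule prob_space_uniform_measure) auto

lemma sets_unit_cube: "unit_cube n \<in> sets (PiM {..<n} (\<lambda>_. borel))"
  by (intro sets_PiM_I_finite) auto

lemma sets_PiM_cong_borel:
  "sets \<mu> = sets borel \<Longrightarrow> sets (PiM I (\<lambda>_. \<mu>)) = sets (PiM I (\<lambda>_. borel))"
  by (intro sets_PiM_cong) auto

lemma PiM_unif: "PiM {..<n} (\<lambda>_. unif) = density (PiM {..<n} (\<lambda>_. lborel)) (indicator (unit_cube n))"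
proof -
  have u: "unif = density lborel (indicator {0<..<1})"
    unfolding uniform_measure_def by (intro density_cong) (auto simp: indicator_def)
  interpret L: product_sigma_finite "\<lambda>_::nat. lborel :: real measure" ..
  interpret U: product_sigma_finite "\<lambda>_::nat. density lborel (indicator {0<..<1}) :: real measure"
    using prob_space_unif
    by (auto simp: product_sigma_finite_def u intro: prob_space_imp_sigma_finite)
  have "PiM {..<n} (\<lambda>_. unif) = density (PiM {..<n} (\<lambda>_. lborel)) (\<lambda>x. \<Prod>i<n. indicator {0<..<1} (x i))"
    unfolding u by (intro PiM_density) (auto intro: L.product_sigma_finite_axioms U.product_sigma_finite_axioms)
  also have "\<dots> = density (PiM {..<n} (\<lambda>_. lborel)) (indicator (unit_cube n))"
  proof (intro density_cong AE_I2)
    show "indicator (unit_cube n) \<in> borel_measurable (PiM {..<n} (\<lambda>_. lborel))"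
      using sets_unit_cube by (intro borel_measurable_indicator) (simp add: sets_PiM_lborel)
    fix x assume "x \<in> space (PiM {..<n} (\<lambda>_. lborel :: real measure))"
    thus "(\<Prod>i<n. indicator {0<..<1} (x i)) = (indicator (unit_cube n) x :: ennreal)"
      by (auto simp: indicator_def space_PiM PiE_iff prod_zero_iff)
  qed simp
  finally show ?thesis .
qed

lemma measurable_compose_PiM:
  assumes [measurable]: "f \<in> borel_measurable borel"
  shows "compose I f \<in> PiM I (\<lambda>_. borel) \<rightarrow>\<^sub>M PiM I (\<lambda>_. borel)"
  unfolding compose_def by measurable

lemma distr_PiM_cdf:
  fixes n :: nat
  assumes "real_distribution \<mu>" and cont: "continuous_on UNIV (cdf \<mu>)"
  shows "distr (PiM {..<n} (\<lambda>_. \<mu>)) (PiM {..<n} (\<lambda>_. borel)) (compose {..<n} (cdf \<mu>)) = PiM {..<n} (\<lambda>_. unif)"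
proof -
  interpret real_distribution \<mu> by fact
  interpret M: product_prob_space "\<lambda>_::nat. \<mu>" by (intro product_prob_spaceI) unfold_locales
  interpret U: product_prob_space "\<lambda>_::nat. unif" by (intro product_prob_spaceI prob_space_unif)
  have [measurable]: "cdf \<mu> \<in> borel_measurable borel"
    using cont by (rule borel_measurable_continuous_onI)
  \<comment> \<open>The product rule for image measures wants probability spaces as targets. Only
    the sigma-algebra of the target matters to \<open>distr\<close>, so \<open>borel\<close> may be
    replaced by \<open>unif\<close>.\<close>
  have "distr (PiM {..<n} (\<lambda>_. \<mu>)) (PiM {..<n} (\<lambda>_. borel)) (compose {..<n} (cdf \<mu>))
      = distr (PiM {..<n} (\<lambda>_. \<mu>)) (PiM {..<n} (\<lambda>_. unif)) (compose {..<n} (cdf \<mu>))"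
    by (intro distr_cong refl sets_PiM_cong_borel[symmetric]) simp
  also have "\<dots> = PiM {..<n} (\<lambda>_. distr \<mu> unif (cdf \<mu>))"
  proof (rule distr_PiM_finite_prob_space)
    show "cdf \<mu> \<in> \<mu> \<rightarrow>\<^sub>M unif"
      by (subst measurable_cong_sets[OF events_eq_borel sets_uniform_measure]) simp
  qed (use M.product_prob_space_axioms U.product_prob_space_axioms in simp_all)
  also have "distr \<mu> unif (cdf \<mu>) = distr \<mu> borel (cdf \<mu>)"
    by (intro distr_cong) auto
  also have "\<dots> = unif" by (rule distr_cdf[OF cont])
  finally show ?thesis .
qed

text \<open>The probability integral transform in every coordinate, which replaces a change of
  variables with a Jacobian. It is applied with the Student density to construct the copula density,
  and with \<open>f2\<close> to reach the scale of the claims. The second part makes up for a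
  possibly non-injective \<open>F\<close>.\<close>

lemma nn_integral_PiM_density_cdf:
  fixes f :: "real \<Rightarrow> real" and n :: nat
  assumes f [measurable]: "f \<in> borel_measurable borel" and nonneg: "\<And>x. 0 \<le> f x"
    and rd: "real_distribution (density lborel (\<lambda>x. ennreal (f x)))"
    and F: "F = cdf (density lborel (\<lambda>x. ennreal (f x)))" and cont: "continuous_on UNIV F"
    and g [measurable]: "g \<in> borel_measurable (PiM {..<n} (\<lambda>_. borel))"
  shows "(\<integral>\<^sup>+v. g v \<partial>PiM {..<n} (\<lambda>_. unif))
    = (\<integral>\<^sup>+x. ennreal (\<Prod>i<n. f (x i)) * g (compose {..<n} F x) \<partial>PiM {..<n} (\<lambda>_. lborel))"
    and "AE x in density (PiM {..<n} (\<lambda>_. lborel)) (\<lambda>x. ennreal (\<Prod>i<n. f (x i))).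
      \<forall>i<n. F (x i) \<le> F (y i) \<longleftrightarrow> x i \<le> y i"
proof -
  let ?\<mu> = "density lborel (\<lambda>x. ennreal (f x))"
  interpret real_distribution ?\<mu> by fact
  have Fm: "F \<in> borel_measurable borel" using cont by (rule borel_measurable_continuous_onI)
  note [measurable] = measurable_compose_PiM[OF Fm, of "{..<n}"]
  interpret L: product_sigma_finite "\<lambda>_::nat. lborel :: real measure" ..
  interpret M: product_sigma_finite "\<lambda>_::nat. ?\<mu>" by unfold_locales
  have "PiM {..<n} (\<lambda>_. ?\<mu>) = density (PiM {..<n} (\<lambda>_. lborel)) (\<lambda>x. \<Prod>i<n. ennreal (f (x i)))"
    by (intro PiM_density) (auto intro: L.product_sigma_finite_axioms M.product_sigma_finite_axioms)
  also have "(\<lambda>x. \<Prod>i<n. ennreal (f (x i))) = (\<lambda>x. ennreal (\<Prod>i<n. f (x i)))"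
    using nonneg by (simp add: prod_ennreal)
  finally have P: "PiM {..<n} (\<lambda>_. ?\<mu>) = density (PiM {..<n} (\<lambda>_. lborel)) (\<lambda>x. ennreal (\<Prod>i<n. f (x i)))" .
  have "(\<integral>\<^sup>+v. g v \<partial>PiM {..<n} (\<lambda>_. unif))
     = (\<integral>\<^sup>+v. g v \<partial>distr (PiM {..<n} (\<lambda>_. ?\<mu>)) (PiM {..<n} (\<lambda>_. borel)) (compose {..<n} F))"
    using distr_PiM_cdf[OF rd] cont by (simp add: F)
  also have "\<dots> = (\<integral>\<^sup>+x. g (compose {..<n} F x) \<partial>PiM {..<n} (\<lambda>_. ?\<mu>))"
    unfolding P by (intro nn_integral_distr) measurable
  also have "\<dots> = (\<integral>\<^sup>+x. ennreal (\<Prod>i<n. f (x i)) * g (compose {..<n} F x) \<partial>PiM {..<n} (\<lambda>_. lborel))"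
    unfolding P by (intro nn_integral_density) measurable
  finally show "(\<integral>\<^sup>+v. g v \<partial>PiM {..<n} (\<lambda>_. unif))
    = (\<integral>\<^sup>+x. ennreal (\<Prod>i<n. f (x i)) * g (compose {..<n} F x) \<partial>PiM {..<n} (\<lambda>_. lborel))" .
  have "AE x in PiM {..<n} (\<lambda>_. ?\<mu>). F (x i) \<le> F (y i) \<longleftrightarrow> x i \<le> y i" if "i < n" for i
    using that AE_cdf_le_iff cont unfolding F
    by (intro AE_PiM_component[where P = "\<lambda>t. cdf ?\<mu> t \<le> cdf ?\<mu> (y i) \<longleftrightarrow> t \<le> y i"])
       (auto intro: prob_space_axioms)
  hence "AE x in PiM {..<n} (\<lambda>_. ?\<mu>). \<forall>i\<in>{..<n}. F (x i) \<le> F (y i) \<longleftrightarrow> x i \<le> y i"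
    by (intro AE_finite_allI) auto
  thus "AE x in density (PiM {..<n} (\<lambda>_. lborel)) (\<lambda>x. ennreal (\<Prod>i<n. f (x i))).
      \<forall>i<n. F (x i) \<le> F (y i) \<longleftrightarrow> x i \<le> y i"
    unfolding P by (auto)
qed

lemma real_distribution_cdf_range:
  "real_distribution \<mu> \<Longrightarrow> 0 \<le> cdf \<mu> x \<and> cdf \<mu> x \<le> 1"
  by (auto intro: finite_borel_measure.cdf_nonneg real_distribution.finite_borel_measure_M
      real_distribution.cdf_bounded_prob)

lemma nn_integral_unif:
  assumes [measurable]: "g \<in> borel_measurable (PiM {..<n} (\<lambda>_. borel))"
  shows "(\<integral>\<^sup>+v. g v \<partial>PiM {..<n} (\<lambda>_. unif)) = (\<integral>\<^sup>+v. g v * indicator (unit_cube n) v \<partial>PiM {..<n} (\<lambda>_. lborel))"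
proof -
  note [measurable] = sets_unit_cube
  have "(\<integral>\<^sup>+v. g v \<partial>PiM {..<n} (\<lambda>_. unif)) = (\<integral>\<^sup>+v. indicator (unit_cube n) v * g v \<partial>PiM {..<n} (\<lambda>_. lborel))"
    unfolding PiM_unif by (intro nn_integral_density) measurable
  thus ?thesis by (simp add: mult.commute)
qed

lemma t_copula_eq_emeasure:
  assumes "prob_space (mvt df S)" "S \<in> carrier_mat n n"
  shows "ennreal (t_copula df S u)
    = emeasure (mvt df S) {x \<in> PiE {..<n} (\<lambda>_. UNIV). \<forall>i<n. ereal (x i) \<le> t_quantile df (u i)}"
proof -
  interpret prob_space "mvt df S" by fact
  show ?thesis using assms(2) by (simp add: t_copula_def emeasure_eq_measure space_mvt)
qed

text \<open>The classical quotient of the joint density by the product of its margins, taken at the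
  quantiles. It is a witness only: it shows that the choice in \<open>t_copula_density\<close> is
  from a nonempty set.\<close>

definition std_copula_density :: "nat \<Rightarrow> real \<Rightarrow> real mat \<Rightarrow> (nat \<Rightarrow> real) \<Rightarrow> real" where
  "std_copula_density n df S v =
     mvt_density df S (compose {..<n} (real_t_quantile df) v) / (\<Prod>i<n. student_density df (real_t_quantile df (v i)))"

lemma sets_lower_orthant [measurable]:
  fixes n :: nat
  shows "{x \<in> PiE {..<n} (\<lambda>_. UNIV). \<forall>i<n. x i \<le> (u i :: real)} \<in> sets (PiM {..<n} (\<lambda>_. borel))"
proof -
  have "{x \<in> PiE {..<n} (\<lambda>_. UNIV). \<forall>i<n. x i \<le> u i}
      = {x \<in> space (PiM {..<n} (\<lambda>_. borel)). \<forall>i\<in>{..<n}. x i \<le> u i}"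
    by (auto simp: space_PiM)
  also have "\<dots> \<in> sets (PiM {..<n} (\<lambda>_. borel))" by measurable
  finally show ?thesis .
qed

lemma emeasure_mvt_le_t_quantile:
  assumes "df > 0" and "\<And>i. i < n \<Longrightarrow> u i \<in> {0..1}"
  shows "emeasure (mvt df S) {x \<in> PiE {..<n} (\<lambda>_. UNIV). \<forall>i<n. ereal (x i) \<le> t_quantile df (u i)}
    = emeasure (mvt df S) {x \<in> PiE {..<n} (\<lambda>_. UNIV). \<forall>i<n. cdf (student_t df) (x i) \<le> u i}"
  using assms(2) le_t_quantile_iff[OF assms(1)] by (intro arg_cong[where f = "emeasure _"]) auto

context
  fixes n :: nat and S :: "real mat" and df :: real
  assumes S: "S \<in> carrier_mat n n" and pd: "pos_def_mat S" and det: "det S > 0" and df: "df > 0"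
    and prob: "prob_space (mvt df S)"
begin

text \<open>Under the substitution of \<open>cdf (student_t df) (x i)\<close> for \<open>v i\<close>
  the weight is the product of Student densities. It cancels the denominator of the witness, and the
  quantiles undo the substitution.\<close>

lemma is_copula_density_std: "is_copula_density n (t_copula df S) (std_copula_density n df S)"
proof -
  note [measurable] = real_t_quantile_measurable[OF df] measurable_compose_PiM[OF real_t_quantile_measurable[OF df], of "{..<n}"]
    mvt_density_measurable[OF pd S] sets_unit_cube
  let ?F = "cdf (student_t df)"
  have cont: "continuous_on UNIV ?F" by (rule continuous_cdf_student_t[OF df])
  hence Fm: "?F \<in> borel_measurable borel" by (rule borel_measurable_continuous_onI)
  note [measurable] = Fm measurable_compose_PiM[OF Fm, of "{..<n}"]
  have m [measurable]: "std_copula_density n df S \<in> borel_measurable (PiM {..<n} (\<lambda>_. borel))"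
    unfolding std_copula_density_def by measurable
  have "std_copula_density n df S \<in> borel_measurable (restrict_space (PiM {..<n} (\<lambda>_. lborel)) (unit_cube n))"
    by (intro measurable_restrict_space1) (simp add: measurable_cong_sets[OF sets_PiM_lborel refl])
  moreover have "0 \<le> std_copula_density n df S v" for v
    unfolding std_copula_density_def
    by (intro divide_nonneg_nonneg mvt_density_nonneg[OF S df det] prod_nonneg) (auto intro: less_imp_le student_density_pos df)
  moreover have "ennreal (t_copula df S u) = (\<integral>\<^sup>+ v \<in> {v \<in> unit_cube n. \<forall>i<n. v i \<le> u i}.
      ennreal (std_copula_density n df S v) \<partial>PiM {..<n} (\<lambda>_. lborel))"
    if u: "\<forall>i<n. u i \<in> {0..1}" for u
  proof -
    define Ov where "Ov = {v \<in> PiE {..<n} (\<lambda>_. UNIV). \<forall>i<n. v i \<le> u i}"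
    have Ov [measurable]: "Ov \<in> sets (PiM {..<n} (\<lambda>_. borel))" unfolding Ov_def by measurable
    have "{v \<in> unit_cube n. \<forall>i<n. v i \<le> u i} = Ov \<inter> unit_cube n"
      using PiE_mono[of "{..<n}" "\<lambda>_. {0<..<1::real}" "\<lambda>_. UNIV"] unfolding Ov_def by blast
    hence "(\<integral>\<^sup>+ v \<in> {v \<in> unit_cube n. \<forall>i<n. v i \<le> u i}.
        ennreal (std_copula_density n df S v) \<partial>PiM {..<n} (\<lambda>_. lborel))
      = (\<integral>\<^sup>+ v. (ennreal (std_copula_density n df S v) * indicator Ov v) * indicator (unit_cube n) v \<partial>PiM {..<n} (\<lambda>_. lborel))"
      by (intro nn_integral_cong) (auto simp: indicator_def)
    also have "\<dots> = (\<integral>\<^sup>+ v. ennreal (std_copula_density n df S v) * indicator Ov v \<partial>PiM {..<n} (\<lambda>_. unif))"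
      by (rule nn_integral_unif[symmetric]) measurable
    also have "\<dots> = (\<integral>\<^sup>+ x. ennreal (\<Prod>i<n. student_density df (x i)) *
        (ennreal (std_copula_density n df S (compose {..<n} ?F x)) * indicator Ov (compose {..<n} ?F x)) \<partial>PiM {..<n} (\<lambda>_. lborel))"
      using real_distribution_student_t[OF df] cont student_density_pos[OF df]
      by (intro nn_integral_PiM_density_cdf) (auto simp: student_t_alt intro: less_imp_le)
    also have "\<dots> = (\<integral>\<^sup>+ x. ennreal (mvt_density df S x) *
        indicator {x \<in> PiE {..<n} (\<lambda>_. UNIV). \<forall>i<n. ?F (x i) \<le> u i} x \<partial>PiM {..<n} (\<lambda>_. lborel))"
    proof (intro nn_integral_cong)
      fix x assume "x \<in> space (PiM {..<n} (\<lambda>_. lborel :: real measure))"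
      hence x: "x \<in> PiE {..<n} (\<lambda>_. UNIV)" by (simp add: space_PiM)
      have inv: "compose {..<n} (real_t_quantile df) (compose {..<n} ?F x) = x"
        using x by (auto simp: compose_def real_t_quantile_cdf[OF df] fun_eq_iff PiE_iff extensional_def)
      have "(\<Prod>i<n. student_density df (real_t_quantile df (compose {..<n} ?F x i))) = (\<Prod>i<n. student_density df (x i))"
        by (intro prod.cong) (auto simp: compose_def real_t_quantile_cdf[OF df])
      moreover have pos: "(\<Prod>i<n. student_density df (x i)) > 0" by (intro prod_pos) (auto intro: student_density_pos df)
      ultimately have "(\<Prod>i<n. student_density df (x i)) * std_copula_density n df S (compose {..<n} ?F x) = mvt_density df S x"
        by (simp add: std_copula_density_def inv del: prod_zero_iff)
      hence "ennreal (\<Prod>i<n. student_density df (x i)) * ennreal (std_copula_density n df S (compose {..<n} ?F x))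
          = ennreal (mvt_density df S x)"
        using pos by (simp flip: ennreal_mult')
      moreover have "indicator Ov (compose {..<n} ?F x)
          = (indicator {x \<in> PiE {..<n} (\<lambda>_. UNIV). \<forall>i<n. ?F (x i) \<le> u i} x :: ennreal)"
        using x by (auto simp: Ov_def indicator_def compose_def)
      ultimately show "ennreal (\<Prod>i<n. student_density df (x i)) *
        (ennreal (std_copula_density n df S (compose {..<n} ?F x)) * indicator Ov (compose {..<n} ?F x))
        = ennreal (mvt_density df S x) *
        indicator {x \<in> PiE {..<n} (\<lambda>_. UNIV). \<forall>i<n. ?F (x i) \<le> u i} x"
        by (simp flip: mult.assoc)
    qed
    also have "\<dots> = emeasure (mvt df S) {x \<in> PiE {..<n} (\<lambda>_. UNIV). \<forall>i<n. ?F (x i) \<le> u i}"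
    proof -
      have "{x \<in> PiE {..<n} (\<lambda>_. UNIV). \<forall>i<n. ?F (x i) \<le> u i}
        = {x \<in> space (PiM {..<n} (\<lambda>_. borel)). \<forall>i\<in>{..<n}. ?F (x i) \<le> u i}"
        by (auto simp: space_PiM)
      also have "\<dots> \<in> sets (PiM {..<n} (\<lambda>_. borel))" by measurable
      finally show ?thesis
        unfolding mvt_eq[OF S] by (intro emeasure_density[symmetric]) (auto simp: sets_PiM_lborel)
    qed
    also have "\<dots> = ennreal (t_copula df S u)"
      using emeasure_mvt_le_t_quantile[OF df, of n u S] u t_copula_eq_emeasure[OF prob S] by simp
    finally show ?thesis ..
  qed
  ultimately show ?thesis by (auto simp: is_copula_density_def)
qed

lemma is_copula_density_t_copula_density:
  "is_copula_density n (t_copula df S) (t_copula_density df S)"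
proof -
  have "dim_row S = n" using S by simp
  thus ?thesis
    unfolding t_copula_density_def
    using someI[of "is_copula_density n (t_copula df S)", OF is_copula_density_std] by simp
qed

end

text \<open>The predicate says nothing about \<open>c\<close> outside the open cube, so
  \<open>c\<close> is extended by zero to become measurable on the whole space.\<close>

lemma copula_density_measurable:
  assumes "is_copula_density n C c"
  shows "(\<lambda>v. c v * indicator (unit_cube n) v) \<in> borel_measurable (PiM {..<n} (\<lambda>_. borel))"
proof -
  have "unit_cube n \<inter> space (PiM {..<n} (\<lambda>_. lborel)) \<in> sets (PiM {..<n} (\<lambda>_. lborel))"
    using sets_unit_cube[of n] by (intro sets.Int sets.top) (simp add: sets_PiM_lborel)
  hence "(\<lambda>v. indicator (unit_cube n) v *\<^sub>R c v) \<in> borel_measurable (PiM {..<n} (\<lambda>_. lborel))"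
    using assms unfolding is_copula_density_def by (subst borel_measurable_restrict_space_iff[symmetric]) auto
  thus ?thesis by (simp add: mult.commute measurable_cong_sets[OF sets_PiM_lborel refl])
qed

text \<open>Any copula density is pinned down as a measure by its integrals over lower orthants.
  This upgrades the defining property from orthants to integrals of arbitrary functions, as is
  required for the conditional distribution function.\<close>

lemma distr_mvt_cdf:
  assumes S: "S \<in> carrier_mat n n" and df: "df > 0" and prob: "prob_space (mvt df S)"
    and c: "is_copula_density n (t_copula df S) c"
  shows "distr (mvt df S) (PiM {..<n} (\<lambda>_. borel)) (compose {..<n} (cdf (student_t df)))
    = density (PiM {..<n} (\<lambda>_. unif)) (\<lambda>v. ennreal (c v * indicator (unit_cube n) v))"
proof (rule measure_eqI_lower_orthants)
  interpret prob_space "mvt df S" by fact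
  let ?F = "cdf (student_t df)"
  note [measurable] = copula_density_measurable[OF c] sets_unit_cube
  have Fm: "?F \<in> borel_measurable borel"
    using continuous_cdf_student_t[OF df] by (rule borel_measurable_continuous_onI)
  have mF: "compose {..<n} ?F \<in> mvt df S \<rightarrow>\<^sub>M PiM {..<n} (\<lambda>_. borel)"
    using measurable_compose_PiM[OF Fm] by (simp add: measurable_cong_sets[OF sets_mvt[OF S] refl])
  show "finite_measure (distr (mvt df S) (PiM {..<n} (\<lambda>_. borel)) (compose {..<n} ?F))"
    using finite_measure_distr[OF mF] .
  have setsU: "sets (PiM {..<n} (\<lambda>_. unif)) = sets (PiM {..<n} (\<lambda>_. borel))"
    by (rule sets_PiM_cong_borel) simp
  thus "sets (density (PiM {..<n} (\<lambda>_. unif)) (\<lambda>v. ennreal (c v * indicator (unit_cube n) v)))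
      = sets (PiM {..<n} (\<lambda>_. borel))" by simp
  fix y :: "nat \<Rightarrow> real"
  \<comment> \<open>The copula identity holds for arguments in [0,1] only. Clamping the bounds to
    that interval does not change the orthant inside the open cube, where all values of the
    transform lie.\<close>
  define u where "u i = max 0 (min 1 (y i))" for i
  have u: "\<And>i. i < n \<Longrightarrow> u i \<in> {0..1}" by (auto simp: u_def)
  have uy: "t \<le> u i \<longleftrightarrow> t \<le> y i" if "t \<in> {0<..<1}" for t i
    using that by (auto simp: u_def)
  let ?O = "{x \<in> PiE {..<n} (\<lambda>_. UNIV). \<forall>i\<in>{..<n}. x i \<le> y i}"
  have O: "?O \<in> sets (PiM {..<n} (\<lambda>_. borel))" using sets_lower_orthant[of n y] by simp
  have "emeasure (distr (mvt df S) (PiM {..<n} (\<lambda>_. borel)) (compose {..<n} ?F)) ?O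
     = emeasure (mvt df S) (compose {..<n} ?F -` ?O \<inter> space (mvt df S))"
    by (rule emeasure_distr[OF mF O])
  also have "compose {..<n} ?F -` ?O \<inter> space (mvt df S) = {x \<in> PiE {..<n} (\<lambda>_. UNIV). \<forall>i<n. ?F (x i) \<le> u i}"
    using uy[OF cdf_student_t_unit_interval[OF df]] by (auto simp: space_mvt[OF S] compose_def)
  also have "emeasure (mvt df S) \<dots> = ennreal (t_copula df S u)"
    using emeasure_mvt_le_t_quantile[OF df, of n u S] u t_copula_eq_emeasure[OF prob S] by simp
  also have "\<dots> = (\<integral>\<^sup>+ v \<in> {v \<in> unit_cube n. \<forall>i<n. v i \<le> u i}. ennreal (c v) \<partial>PiM {..<n} (\<lambda>_. lborel))"
    using c u unfolding is_copula_density_def by auto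
  also have "\<dots> = (\<integral>\<^sup>+ v. (ennreal (c v * indicator (unit_cube n) v) * indicator ?O v) * indicator (unit_cube n) v \<partial>PiM {..<n} (\<lambda>_. lborel))"
    using uy by (intro nn_integral_cong) (auto simp: indicator_def PiE_iff)
  also have "\<dots> = (\<integral>\<^sup>+ v. ennreal (c v * indicator (unit_cube n) v) * indicator ?O v \<partial>PiM {..<n} (\<lambda>_. unif))"
    using O by (intro nn_integral_unif[symmetric]) measurable
  also have "\<dots> = emeasure (density (PiM {..<n} (\<lambda>_. unif)) (\<lambda>v. ennreal (c v * indicator (unit_cube n) v))) ?O"
    using O by (intro emeasure_density[symmetric]) (auto simp: setsU measurable_cong_sets[OF setsU refl])
  finally show "emeasure (distr (mvt df S) (PiM {..<n} (\<lambda>_. borel)) (compose {..<n} ?F)) ?O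
    = emeasure (density (PiM {..<n} (\<lambda>_. unif)) (\<lambda>v. ennreal (c v * indicator (unit_cube n) v))) ?O" .
qed auto

section \<open>The law of the claims\<close>

definition count_cond_cdf ::
  "real \<Rightarrow> (real \<Rightarrow> real) \<Rightarrow> real \<Rightarrow> real \<Rightarrow> nat \<Rightarrow> nat \<Rightarrow> ereal \<Rightarrow> (nat \<Rightarrow> real) \<Rightarrow> real" where
  "count_cond_cdf df F2 \<rho>1 \<rho>2 n z a y = t_cdf (df + real n)
     ((a - ereal (mu_star df F2 \<rho>1 \<rho>2 n z y)) / ereal (sigma_star df F2 \<rho>1 \<rho>2 n z y))"

text \<open>The indicator of the open cube encodes the convention that the formula is 0 where some
  \<open>F2 (y i)\<close> is 0 or 1, where the chosen copula density is unconstrained.\<close>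

definition claims_density ::
  "real \<Rightarrow> (real \<Rightarrow> real) \<Rightarrow> (real \<Rightarrow> real) \<Rightarrow> real \<Rightarrow> nat \<Rightarrow> nat \<Rightarrow> (nat \<Rightarrow> real) \<Rightarrow> real" where
  "claims_density df F2 f2 \<rho>2 n z y = (\<Prod>i<n. f2 (y i)) *
     (t_copula_density df (Sigma_claims \<rho>2 n z) (compose {..<n} F2 y) * indicator (unit_cube n) (compose {..<n} F2 y))"

lemma mu_star_eq: "mu_star df F2 \<rho>1 \<rho>2 n z y =
    cond_mean n (\<rho>1 \<cdot>\<^sub>v ones_vec n) (Sigma_claims \<rho>2 n z) (compose {..<n} (real_t_quantile df) (compose {..<n} F2 y))"
  and sigma_star_eq: "sigma_star df F2 \<rho>1 \<rho>2 n z y =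
    cond_scale df n (\<rho>1 \<cdot>\<^sub>v ones_vec n) (Sigma_claims \<rho>2 n z) (compose {..<n} (real_t_quantile df) (compose {..<n} F2 y))"
proof -
  have "q_vec df F2 n y = Matrix.vec n (compose {..<n} (real_t_quantile df) (compose {..<n} F2 y))"
    by (intro eq_vecI) (auto simp: q_vec_def compose_def real_t_quantile_def)
  thus "mu_star df F2 \<rho>1 \<rho>2 n z y =
    cond_mean n (\<rho>1 \<cdot>\<^sub>v ones_vec n) (Sigma_claims \<rho>2 n z) (compose {..<n} (real_t_quantile df) (compose {..<n} F2 y))"
    "sigma_star df F2 \<rho>1 \<rho>2 n z y =
    cond_scale df n (\<rho>1 \<cdot>\<^sub>v ones_vec n) (Sigma_claims \<rho>2 n z) (compose {..<n} (real_t_quantile df) (compose {..<n} F2 y))"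
    by (simp_all add: mu_star_def cond_mean_def sigma_star_def cond_scale_def quad_form_def schur_complement_def Let_def)
qed

context
  fixes df \<rho>1 \<rho>2 :: real and n z :: nat and f2 F2 :: "real \<Rightarrow> real"
  assumes df: "df > 0" and n: "n \<ge> 1"
    and pdc: "\<And>k. k \<ge> 1 \<Longrightarrow> pos_def_mat (Sigma_claims \<rho>2 k z)"
    and pdj: "\<And>k. k \<ge> 1 \<Longrightarrow> pos_def_mat (Sigma_joint \<rho>1 \<rho>2 k z)"
    and f2: "f2 \<in> borel_measurable borel" and f2_nonneg: "\<And>y. 0 \<le> f2 y"
    and rd: "real_distribution (density lborel (\<lambda>y. ennreal (f2 y)))"
    and F2: "F2 = cdf (density lborel (\<lambda>y. ennreal (f2 y)))"
    and cont: "continuous_on UNIV F2"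
begin

private abbreviation (input) "S \<equiv> Sigma_claims \<rho>2 n z"
private abbreviation (input) "r \<equiv> \<rho>1 \<cdot>\<^sub>v ones_vec n"

private lemma S: "S \<in> carrier_mat n n" by (rule Sigma_claims_carrier)
private lemma r: "r \<in> carrier_vec n" by (simp add: ones_vec_def)
private lemma pd: "pos_def_mat S" "pos_def_mat (bordered r S)"
  using pdc pdj n by (auto simp: Sigma_joint_bordered)
private lemma det_pos: "det S > 0" using pdc by (rule det_Sigma_claims_pos)
private lemma prob: "prob_space (mvt df S)" using pdc df by (rule prob_space_mvt_Sigma_claims)
private lemma copula_density: "is_copula_density n (t_copula df S) (t_copula_density df S)"
  by (rule is_copula_density_t_copula_density[OF S pd(1) det_pos df prob])
private lemma F2_measurable: "F2 \<in> borel_measurable borel"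
  using cont by (rule borel_measurable_continuous_onI)

lemma F2_range: "0 \<le> F2 x" "F2 x \<le> 1"
  using real_distribution_cdf_range[OF rd] by (auto simp: F2)

lemma sigma_star_pos: "sigma_star df F2 \<rho>1 \<rho>2 n z y > 0"
  unfolding sigma_star_eq by (rule cond_scale_pos[OF r S pd det_pos df])

lemma count_cond_cdf_mono: "a \<le> b \<Longrightarrow> count_cond_cdf df F2 \<rho>1 \<rho>2 n z a y \<le> count_cond_cdf df F2 \<rho>1 \<rho>2 n z b y"
  unfolding count_cond_cdf_def using sigma_star_pos[of y] df
  by (intro t_cdf_mono ereal_divide_right_mono ereal_minus_mono) auto

lemma count_cond_cdf_nonneg: "0 \<le> count_cond_cdf df F2 \<rho>1 \<rho>2 n z a y"
  by (simp add: count_cond_cdf_def t_cdf_def)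

private lemma copula_density_nonneg: "0 \<le> t_copula_density df S v * indicator (unit_cube n) v"
  using copula_density by (cases "v \<in> unit_cube n") (simp_all add: is_copula_density_def)

lemma claims_density_nonneg: "0 \<le> claims_density df F2 f2 \<rho>2 n z y"
  unfolding claims_density_def using f2_nonneg
  by (intro mult_nonneg_nonneg[OF prod_nonneg copula_density_nonneg]) auto

text \<open>Stated on the cube, before \<open>F2\<close> is inserted, because the integral is first
  transferred there and only then to the claims.\<close>

private lemma count_cond_cdf_uncomposed_measurable:
  "(\<lambda>v. t_cdf (df + real n) ((a - ereal (cond_mean n r S (compose {..<n} (real_t_quantile df) v))) /
     ereal (cond_scale df n r S (compose {..<n} (real_t_quantile df) v)))) \<in> borel_measurable (PiM {..<n} (\<lambda>_. borel))"
proof -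
  note [measurable] = measurable_compose_PiM[OF real_t_quantile_measurable[OF df], of "{..<n}"]
    cond_mean_measurable[OF pd(1) S r] cond_scale_measurable[OF pd(1) S, of df r]
  show ?thesis using df by (intro borel_measurable_t_cdf_standardized) auto
qed

lemma count_cond_cdf_measurable: "count_cond_cdf df F2 \<rho>1 \<rho>2 n z a \<in> borel_measurable (PiM {..<n} (\<lambda>_. borel))"
  using measurable_compose[OF measurable_compose_PiM[OF F2_measurable] count_cond_cdf_uncomposed_measurable]
  unfolding count_cond_cdf_def[abs_def] mu_star_eq sigma_star_eq .

lemma claims_density_measurable:
  "claims_density df F2 f2 \<rho>2 n z \<in> borel_measurable (PiM {..<n} (\<lambda>_. borel))"
proof -
  note [measurable] = f2 measurable_compose[OF measurable_compose_PiM[OF F2_measurable] copula_density_measurable[OF copula_density]]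
  show ?thesis unfolding claims_density_def[abs_def] by measurable
qed

text \<open>The integral passes through three scales: latent t-values, the cube, and claim amounts.
  The first passage brings in the copula density by \<open>distr_mvt_cdf\<close>, the second brings
  in the product of the \<open>f2 (x i)\<close>.\<close>

lemma t_copula_joint_eq_nn_integral:
  assumes u: "0 \<le> u" "u \<le> 1"
  shows "ennreal (t_copula df (Sigma_joint \<rho>1 \<rho>2 n z) (case_nat u (\<lambda>i. F2 (y i))))
    = (\<integral>\<^sup>+x. ennreal (claims_density df F2 f2 \<rho>2 n z x * count_cond_cdf df F2 \<rho>1 \<rho>2 n z (t_quantile df u) x)
        * indicator {x. \<forall>i<n. x i \<le> y i} x \<partial>PiM {..<n} (\<lambda>_. lborel))"
proof -
  let ?F = "cdf (student_t df)" and ?a = "t_quantile df u"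
  let ?c = "\<lambda>v. t_copula_density df S v * indicator (unit_cube n) v"
  define T where "T x = t_cdf (df + real n) ((?a - ereal (cond_mean n r S x)) / ereal (cond_scale df n r S x))" for x
  define Ov where "Ov = {v \<in> PiE {..<n} (\<lambda>_. UNIV). \<forall>i<n. v i \<le> F2 (y i)}"
  have [measurable]: "Ov \<in> sets (PiM {..<n} (\<lambda>_. borel))" unfolding Ov_def by measurable
  have [measurable]: "(\<lambda>v. T (compose {..<n} (real_t_quantile df) v)) \<in> borel_measurable (PiM {..<n} (\<lambda>_. borel))"
    unfolding T_def by (rule count_cond_cdf_uncomposed_measurable)
  note [measurable] = copula_density_measurable[OF copula_density]
  have Fm: "?F \<in> borel_measurable borel"
    using continuous_cdf_student_t[OF df] by (rule borel_measurable_continuous_onI)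
  have mF: "compose {..<n} ?F \<in> mvt df S \<rightarrow>\<^sub>M PiM {..<n} (\<lambda>_. borel)"
    using measurable_compose_PiM[OF Fm] by (simp add: measurable_cong_sets[OF sets_mvt[OF S] refl])
  have setsU: "sets (PiM {..<n} (\<lambda>_. unif)) = sets (PiM {..<n} (\<lambda>_. borel))"
    by (rule sets_PiM_cong_borel) simp
  have "ennreal (t_copula df (Sigma_joint \<rho>1 \<rho>2 n z) (case_nat u (\<lambda>i. F2 (y i))))
    = emeasure (mvt df (bordered r S)) {x \<in> PiE {..<Suc n} (\<lambda>_. UNIV).
         \<forall>i<Suc n. ereal (x i) \<le> t_quantile df (case_nat u (\<lambda>i. F2 (y i)) i)}"
    unfolding Sigma_joint_bordered
    by (rule t_copula_eq_emeasure[OF prob_space_mvt_bordered[OF r S pd det_pos df prob] bordered_carrier[OF r S]])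
  also have "\<dots> = emeasure (mvt df (bordered r S)) {x \<in> PiE {..<Suc n} (\<lambda>_. UNIV).
      ereal (x 0) \<le> ?a \<and> (\<forall>i<n. ereal (x (Suc i)) \<le> t_quantile df (F2 (y i)))}"
    by (simp add: All_less_Suc2)
  also have "\<dots> = (\<integral>\<^sup>+x. ennreal (T x) * indicator {x. \<forall>i<n. ereal (x i) \<le> t_quantile df (F2 (y i))} x \<partial>mvt df S)"
    unfolding T_def by (rule emeasure_mvt_bordered[OF r S pd det_pos df])
  \<comment> \<open>Inserting the quantile of the distribution function turns the integrand into a
    function of the transformed point, the form needed for integrating against the image
    measure.\<close>
  also have "\<dots> = (\<integral>\<^sup>+x. ennreal (T (compose {..<n} (real_t_quantile df) (compose {..<n} ?F x))) * indicator Ov (compose {..<n} ?F x) \<partial>mvt df S)"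
  proof (intro nn_integral_cong)
    fix x assume "x \<in> space (mvt df S)"
    hence x: "x \<in> PiE {..<n} (\<lambda>_. UNIV)" by (simp add: space_mvt[OF S])
    have inv: "compose {..<n} (real_t_quantile df) (compose {..<n} ?F x) = x"
      using x by (auto simp: compose_def real_t_quantile_cdf[OF df] fun_eq_iff PiE_iff extensional_def)
    have "indicator Ov (compose {..<n} ?F x)
      = (indicator {x. \<forall>i<n. ereal (x i) \<le> t_quantile df (F2 (y i))} x :: ennreal)"
      using le_t_quantile_iff[OF df F2_range] by (auto simp: Ov_def indicator_def compose_def)
    thus "ennreal (T x) * indicator {x. \<forall>i<n. ereal (x i) \<le> t_quantile df (F2 (y i))} x =
       ennreal (T (compose {..<n} (real_t_quantile df) (compose {..<n} ?F x))) * indicator Ov (compose {..<n} ?F x)"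
      by (simp only: inv)
  qed
  also have "\<dots> = (\<integral>\<^sup>+v. ennreal (T (compose {..<n} (real_t_quantile df) v)) * indicator Ov v
      \<partial>distr (mvt df S) (PiM {..<n} (\<lambda>_. borel)) (compose {..<n} ?F))"
    by (subst nn_integral_distr[OF mF]) measurable
  also have "\<dots> = (\<integral>\<^sup>+v. ennreal (?c v) * (ennreal (T (compose {..<n} (real_t_quantile df) v)) * indicator Ov v) \<partial>PiM {..<n} (\<lambda>_. unif))"
    unfolding distr_mvt_cdf[OF S df prob copula_density]
    by (intro nn_integral_density; subst measurable_cong_sets[OF setsU refl]) measurable
  also have "\<dots> = (\<integral>\<^sup>+x. ennreal (\<Prod>i<n. f2 (x i)) * (ennreal (?c (compose {..<n} F2 x)) *
      (ennreal (T (compose {..<n} (real_t_quantile df) (compose {..<n} F2 x))) * indicator Ov (compose {..<n} F2 x))) \<partial>PiM {..<n} (\<lambda>_. lborel))"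
    by (rule nn_integral_PiM_density_cdf(1)[OF f2 f2_nonneg rd F2 cont]) measurable
  also have "\<dots> = (\<integral>\<^sup>+x. ennreal (claims_density df F2 f2 \<rho>2 n z x * count_cond_cdf df F2 \<rho>1 \<rho>2 n z ?a x)
        * indicator {x. \<forall>i<n. x i \<le> y i} x \<partial>PiM {..<n} (\<lambda>_. lborel))"
  proof (rule nn_integral_cong_AE)
    \<comment> \<open>The orthant is still expressed by \<open>F2 (x i) \<le> F2 (y i)\<close>.
      Almost everywhere where the product of the \<open>f2 (x i)\<close> is positive, this means
      \<open>x i \<le> y i\<close>; where the product vanishes, both integrands are 0.\<close>
    have "AE x in density (PiM {..<n} (\<lambda>_. lborel)) (\<lambda>x. ennreal (\<Prod>i<n. f2 (x i))).
      \<forall>i<n. F2 (x i) \<le> F2 (y i) \<longleftrightarrow> x i \<le> y i"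
      by (rule nn_integral_PiM_density_cdf(2)[OF f2 f2_nonneg rd F2 cont, of "\<lambda>_. 0"]) simp
    moreover have "(\<lambda>x. ennreal (\<Prod>i<n. f2 (x i))) \<in> borel_measurable (PiM {..<n} (\<lambda>_. lborel))"
      using f2 by measurable
    ultimately have "AE x in PiM {..<n} (\<lambda>_. lborel). 0 < ennreal (\<Prod>i<n. f2 (x i)) \<longrightarrow>
      (\<forall>i<n. F2 (x i) \<le> F2 (y i) \<longleftrightarrow> x i \<le> y i)"
      by (simp add: AE_density)
    thus "AE x in PiM {..<n} (\<lambda>_. lborel). ennreal (\<Prod>i<n. f2 (x i)) * (ennreal (?c (compose {..<n} F2 x)) *
      (ennreal (T (compose {..<n} (real_t_quantile df) (compose {..<n} F2 x))) * indicator Ov (compose {..<n} F2 x)))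
      = ennreal (claims_density df F2 f2 \<rho>2 n z x * count_cond_cdf df F2 \<rho>1 \<rho>2 n z ?a x)
        * indicator {x. \<forall>i<n. x i \<le> y i} x"
    proof eventually_elim
      case (elim x)
      have nn: "0 \<le> (\<Prod>i<n. f2 (x i))" using f2_nonneg by (intro prod_nonneg) auto
      have c_nn: "0 \<le> ?c (compose {..<n} F2 x)" by (rule copula_density_nonneg)
      have T: "T (compose {..<n} (real_t_quantile df) (compose {..<n} F2 x)) = count_cond_cdf df F2 \<rho>1 \<rho>2 n z ?a x"
        by (simp add: T_def count_cond_cdf_def mu_star_eq sigma_star_eq)
      have eq: "ennreal (claims_density df F2 f2 \<rho>2 n z x * count_cond_cdf df F2 \<rho>1 \<rho>2 n z ?a x)
        = ennreal (\<Prod>i<n. f2 (x i)) * (ennreal (?c (compose {..<n} F2 x)) * ennreal (count_cond_cdf df F2 \<rho>1 \<rho>2 n z ?a x))"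
        unfolding claims_density_def ennreal_mult[OF mult_nonneg_nonneg[OF nn c_nn] count_cond_cdf_nonneg]
          ennreal_mult[OF nn c_nn] by (simp only: mult.assoc)
      show ?case
      proof (cases "(\<Prod>i<n. f2 (x i)) = 0")
        case True
        thus ?thesis unfolding eq by (simp del: prod_zero_iff)
      next
        case False
        with nn elim have "\<forall>i<n. F2 (x i) \<le> F2 (y i) \<longleftrightarrow> x i \<le> y i" by simp
        hence "indicator Ov (compose {..<n} F2 x) = (indicator {x. \<forall>i<n. x i \<le> y i} x :: ennreal)"
          by (auto simp: Ov_def indicator_def compose_def)
        thus ?thesis unfolding eq T by (simp only: mult.assoc)
      qed
    qed
  qed
  finally show ?thesis .
qed

text \<open>The model prescribes only cumulative events in the count, so these come first. The bound
  \<open>m\<close> is independent of the dimension \<open>n\<close>, because the same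
  \<open>n\<close> claims are needed for the bounds \<open>n\<close> and
  \<open>n - 1\<close>.\<close>

lemma emeasure_claims_le_eq:
  fixes M :: "'a measure" and Np :: "'a \<Rightarrow> nat" and Y :: "nat \<Rightarrow> 'a \<Rightarrow> real"
  assumes "prob_space M" and model: "t_copula_conditional_model M Np Y F1 F2 df \<rho>1 \<rho>2 z"
    and B: "B \<in> sets (PiM {..<n} (\<lambda>_. borel))"
  shows "emeasure M {\<omega> \<in> space M. Np \<omega> \<le> m \<and> restrict (\<lambda>i. Y i \<omega>) {..<n} \<in> B}
    = (\<integral>\<^sup>+x. ennreal (claims_density df F2 f2 \<rho>2 n z x *
          count_cond_cdf df F2 \<rho>1 \<rho>2 n z (t_quantile df (F1 (real m))) x) * indicator B x \<partial>PiM {..<n} (\<lambda>_. lborel))"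
proof -
  interpret prob_space M by fact
  have [measurable]: "Np \<in> M \<rightarrow>\<^sub>M count_space UNIV" "\<And>i. Y i \<in> borel_measurable M"
    using model by (auto simp: t_copula_conditional_model_def)
  have F1: "F1 = cdf (distr M borel (\<lambda>\<omega>. real (Np \<omega>)))"
    using model by (auto simp: t_copula_conditional_model_def)
  have F1_range: "0 \<le> F1 x" "F1 x \<le> 1" for x
    unfolding F1 using real_distribution_cdf_range[OF real_distribution_distr, of "\<lambda>\<omega>. real (Np \<omega>)"] by auto
  let ?X = "\<lambda>\<omega>. restrict (\<lambda>i. Y i \<omega>) {..<n}"
  let ?A = "{\<omega> \<in> space M. Np \<omega> \<le> m}"
  let ?g = "\<lambda>x. claims_density df F2 f2 \<rho>2 n z x * count_cond_cdf df F2 \<rho>1 \<rho>2 n z (t_quantile df (F1 (real m))) x"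
  note [measurable] = claims_density_measurable count_cond_cdf_measurable
  \<comment> \<open>Weighting \<open>M\<close> by the indicator of the event keeps a finite measure,
    to which uniqueness on lower orthants applies for fixed \<open>m\<close>.\<close>
  let ?P = "distr (density M (indicator ?A)) (PiM {..<n} (\<lambda>_. borel)) ?X"
  let ?Q = "density (PiM {..<n} (\<lambda>_. lborel)) (\<lambda>x. ennreal (?g x))"
  have P: "emeasure ?P B = emeasure M {\<omega> \<in> space M. Np \<omega> \<le> m \<and> ?X \<omega> \<in> B}"
    if B: "B \<in> sets (PiM {..<n} (\<lambda>_. borel))" for B
  proof -
    have X: "?X \<in> M \<rightarrow>\<^sub>M PiM {..<n} (\<lambda>_. borel)" by measurable
    have "emeasure ?P B = emeasure (density M (indicator ?A)) (?X -` B \<inter> space M)"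
      using X B by (subst emeasure_distr) auto
    also have "\<dots> = emeasure M (?A \<inter> (?X -` B \<inter> space M))"
      using measurable_sets[OF X B] by (intro emeasure_restricted) auto
    also have "?A \<inter> (?X -` B \<inter> space M) = {\<omega> \<in> space M. Np \<omega> \<le> m \<and> ?X \<omega> \<in> B}" by auto
    finally show ?thesis .
  qed
  have Q: "emeasure ?Q B = (\<integral>\<^sup>+x. ennreal (?g x) * indicator B x \<partial>PiM {..<n} (\<lambda>_. lborel))"
    if B: "B \<in> sets (PiM {..<n} (\<lambda>_. borel))" for B
    using B by (intro emeasure_density) (auto simp: sets_PiM_lborel)
  have "?P = ?Q"
  proof (rule measure_eqI_lower_orthants)
    show "finite_measure ?P"
      by (intro finite_measure.finite_measure_distr finite_measure_restricted) measurable
    show "sets ?Q = sets (PiM {..<n} (\<lambda>_. borel))" by (simp add: sets_PiM_lborel)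
    fix y :: "nat \<Rightarrow> real"
    let ?O = "{x \<in> PiE {..<n} (\<lambda>_. UNIV). \<forall>i\<in>{..<n}. x i \<le> y i}"
    have O: "?O \<in> sets (PiM {..<n} (\<lambda>_. borel))" using sets_lower_orthant[of n y] by simp
    have "emeasure ?P ?O = emeasure M {\<omega> \<in> space M. Np \<omega> \<le> m \<and> (\<forall>i<n. Y i \<omega> \<le> y i)}"
      unfolding P[OF O] by (intro arg_cong[where f = "emeasure M"]) auto
    also have "\<dots> = ennreal (t_copula df (Sigma_joint \<rho>1 \<rho>2 n z) (case_nat (F1 (real m)) (\<lambda>i. F2 (y i))))"
      using model n by (simp add: t_copula_conditional_model_def emeasure_eq_measure)
    also have "\<dots> = (\<integral>\<^sup>+x. ennreal (?g x) * indicator {x. \<forall>i<n. x i \<le> y i} x \<partial>PiM {..<n} (\<lambda>_. lborel))"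
      by (rule t_copula_joint_eq_nn_integral[OF F1_range])
    also have "\<dots> = (\<integral>\<^sup>+x. ennreal (?g x) * indicator ?O x \<partial>PiM {..<n} (\<lambda>_. lborel))"
      by (intro nn_integral_cong) (auto simp: indicator_def space_PiM)
    also have "\<dots> = emeasure ?Q ?O" by (rule Q[OF O, symmetric])
    finally show "emeasure ?P ?O = emeasure ?Q ?O" .
  qed auto
  thus ?thesis using P[OF B] Q[OF B] by simp
qed

text \<open>Both sides are added to the quantity for the bound \<open>n - 1\<close>, which is then
  cancelled; this is legitimate in \<open>ennreal\<close> since that quantity is finite. The second
  conclusion gives the sign of the difference, hence nonnegativity of the density.\<close>

lemma emeasure_claims_eq:
  fixes M :: "'a measure" and Np :: "'a \<Rightarrow> nat" and Y :: "nat \<Rightarrow> 'a \<Rightarrow> real"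
  assumes "prob_space M" and model: "t_copula_conditional_model M Np Y F1 F2 df \<rho>1 \<rho>2 z"
    and B: "B \<in> sets (PiM {..<n} (\<lambda>_. borel))"
  shows "emeasure M {\<omega> \<in> space M. Np \<omega> = n \<and> restrict (\<lambda>i. Y i \<omega>) {..<n} \<in> B}
    = (\<integral>\<^sup>+x. ennreal (claims_density df F2 f2 \<rho>2 n z x *
          (count_cond_cdf df F2 \<rho>1 \<rho>2 n z (t_quantile df (F1 (real n))) x -
           count_cond_cdf df F2 \<rho>1 \<rho>2 n z (t_quantile df (F1 (real n - 1))) x)) * indicator B x \<partial>PiM {..<n} (\<lambda>_. lborel))"
    (is "?L = (\<integral>\<^sup>+x. ennreal (?f x * (?T x - ?T' x)) * indicator B x \<partial>?N)")
    and "t_quantile df (F1 (real n - 1)) \<le> t_quantile df (F1 (real n))"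
proof -
  interpret prob_space M by fact
  have [measurable]: "Np \<in> M \<rightarrow>\<^sub>M count_space UNIV" "\<And>i. Y i \<in> borel_measurable M"
    using model by (auto simp: t_copula_conditional_model_def)
  have F1: "F1 = cdf (distr M borel (\<lambda>\<omega>. real (Np \<omega>)))"
    using model by (auto simp: t_copula_conditional_model_def)
  have rdN: "real_distribution (distr M borel (\<lambda>\<omega>. real (Np \<omega>)))" by (intro real_distribution_distr) measurable
  have F1_range: "0 \<le> F1 x" "F1 x \<le> 1" for x
    unfolding F1 using real_distribution_cdf_range[OF rdN] by auto
  have "F1 (real n - 1) \<le> F1 (real n)"
    unfolding F1 by (intro finite_borel_measure.cdf_nondecreasing real_distribution.finite_borel_measure_M rdN) simp
  thus le: "t_quantile df (F1 (real n - 1)) \<le> t_quantile df (F1 (real n))"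
    by (intro t_quantile_mono df F1_range)
  have TT: "?T' x \<le> ?T x" for x by (rule count_cond_cdf_mono[OF le])
  note [measurable] = claims_density_measurable count_cond_cdf_measurable B
  \<comment> \<open>The formula subtracts in the reals, while the count bound subtracts in the
    naturals; the two agree because \<open>n\<close> is at least 1.\<close>
  have n1: "real n - 1 = real (n - 1)" using n by simp
  let ?E = "\<lambda>Q. emeasure M {\<omega> \<in> space M. Q (Np \<omega>) \<and> restrict (\<lambda>i. Y i \<omega>) {..<n} \<in> B}"
  have [measurable]: "(\<lambda>\<omega>. restrict (\<lambda>i. Y i \<omega>) {..<n}) \<in> M \<rightarrow>\<^sub>M PiM {..<n} (\<lambda>_. borel)" by measurable
  have "?E (\<lambda>k. k \<le> n - 1) + ?L = ?E (\<lambda>k. k \<le> n)"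
    using n by (subst plus_emeasure) (auto intro!: arg_cong[where f = "emeasure M"])
  moreover have "?E (\<lambda>k. k \<le> n) = (\<integral>\<^sup>+x. ennreal (?f x * ?T x) * indicator B x \<partial>?N)"
    by (rule emeasure_claims_le_eq[OF assms])
  moreover have "\<dots> = (\<integral>\<^sup>+x. ennreal (?f x * ?T' x) * indicator B x \<partial>?N) +
      (\<integral>\<^sup>+x. ennreal (?f x * (?T x - ?T' x)) * indicator B x \<partial>?N)"
  proof (subst nn_integral_add[symmetric])
    show "(\<integral>\<^sup>+x. ennreal (?f x * ?T x) * indicator B x \<partial>?N)
      = (\<integral>\<^sup>+x. ennreal (?f x * ?T' x) * indicator B x + ennreal (?f x * (?T x - ?T' x)) * indicator B x \<partial>?N)"
    proof (intro nn_integral_cong)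
      fix x
      have "ennreal (?f x * ?T x) = ennreal (?f x * ?T' x) + ennreal (?f x * (?T x - ?T' x))"
        using claims_density_nonneg[of x] count_cond_cdf_nonneg[of _ x] TT[of x]
        by (subst ennreal_plus[symmetric]) (auto simp: algebra_simps intro: mult_left_mono)
      thus "ennreal (?f x * ?T x) * indicator B x = ennreal (?f x * ?T' x) * indicator B x + ennreal (?f x * (?T x - ?T' x)) * indicator B x"
        by (simp add: distrib_right)
    qed
  qed measurable
  moreover have "(\<integral>\<^sup>+x. ennreal (?f x * ?T' x) * indicator B x \<partial>?N) = ?E (\<lambda>k. k \<le> n - 1)"
    unfolding n1 by (rule emeasure_claims_le_eq[OF assms, symmetric])
  ultimately have "?E (\<lambda>k. k \<le> n - 1) + ?L = ?E (\<lambda>k. k \<le> n - 1) +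
      (\<integral>\<^sup>+x. ennreal (?f x * (?T x - ?T' x)) * indicator B x \<partial>?N)"
    by simp
  thus "?L = (\<integral>\<^sup>+x. ennreal (?f x * (?T x - ?T' x)) * indicator B x \<partial>?N)"
    by (subst (asm) ennreal_add_left_cancel) simp
qed

lemma claims_density_eq:
  assumes "y \<in> PiE {..<n} (\<lambda>_. UNIV)"
  shows "claims_density df F2 f2 \<rho>2 n z y = (if \<exists>i<n. F2 (y i) \<in> {0, 1} then 0 else f_star df F2 f2 \<rho>2 n z y)"
proof -
  have "compose {..<n} F2 y \<in> unit_cube n \<longleftrightarrow> (\<forall>i<n. F2 (y i) \<in> {0<..<1})"
    by (auto simp: PiE_iff compose_def)
  also have "\<dots> \<longleftrightarrow> \<not> (\<exists>i<n. F2 (y i) \<in> {0, 1})"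
    using F2_range by (auto simp: order.strict_iff_order)
  finally show ?thesis
    by (simp add: claims_density_def f_star_def compose_def)
qed

end

section \<open>From the conditional model to the collective risk model\<close>

theorem theorem4:
  fixes M :: "'a measure"
    and R :: "'a \<Rightarrow> bool"
    and Np :: "'a \<Rightarrow> nat"
    and Y :: "nat \<Rightarrow> 'a \<Rightarrow> real"
    and F1 F2 f2 :: "real \<Rightarrow> real"
    and p df \<rho>1 \<rho>2 :: real
    and z :: nat
  assumes "prob_space M"
    and "z \<in> {1, 2}"
    and "df > 0"
    and "\<rho>1 \<in> {-1<..<1}" and "\<rho>2 \<in> {-1<..<1}"
    and "z = 1 \<Longrightarrow> \<rho>1\<^sup>2 < \<rho>2"
    and "\<And>k. k \<ge> 1 \<Longrightarrow> pos_def_mat (Sigma_claims \<rho>2 k z)"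
    and "\<And>k. k \<ge> 1 \<Longrightarrow> pos_def_mat (Sigma_joint \<rho>1 \<rho>2 k z)"
    and "f2 \<in> borel_measurable borel" and "\<And>y. 0 \<le> f2 y"
    and "real_distribution (density lborel (\<lambda>y. ennreal (f2 y)))"
    and "F2 = cdf (density lborel (\<lambda>y. ennreal (f2 y)))"
    and "continuous_on UNIV F2" and "\<And>y. y < 0 \<Longrightarrow> F2 y = 0"
    and "t_copula_conditional_model M Np Y F1 F2 df \<rho>1 \<rho>2 z"
    and "p \<in> {0..1}"
    and "distr M (count_space UNIV) R = measure_pmf (bernoulli_pmf p)"
    and "\<And>k. k \<ge> 1 \<Longrightarrow>
           indep_rv M (count_space UNIV) R
             (count_space UNIV \<Otimes>\<^sub>M PiM {..<k} (\<lambda>_. borel))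
             (\<lambda>\<omega>. (Np \<omega>, restrict (\<lambda>i. Y i \<omega>) {..<k}))"
  shows "is_joint_density M (collective_risk R Np Y)
    (\<lambda>n y.
       if n = 0 then 1 - p
       else if \<exists>i<n. F2 (y i) \<in> {0, 1} then 0
       else p * f_star df F2 f2 \<rho>2 n z y *
         (t_cdf (df + real n)
            ((t_quantile df (F1 (real n)) - ereal (mu_star df F2 \<rho>1 \<rho>2 n z y))
               / ereal (sigma_star df F2 \<rho>1 \<rho>2 n z y)) -
          t_cdf (df + real n)
            ((t_quantile df (F1 (real n - 1)) - ereal (mu_star df F2 \<rho>1 \<rho>2 n z y))
               / ereal (sigma_star df F2 \<rho>1 \<rho>2 n z y))))"
proof -
  interpret prob_space M by fact
  note df = \<open>df > 0\<close> and pdc = assms(7) and pdj = assms(8) and f2 = assms(9) and f2_nonneg = assms(10)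
    and rd = assms(11) and F2 = assms(12) and cont = assms(13) and model = assms(15) and p = assms(16)
    and R_law = assms(17) and indep = assms(18)
  have Np1: "1 \<le> Np \<omega>" if "\<omega> \<in> space M" for \<omega>
    using model that by (auto simp: t_copula_conditional_model_def)
  have R [measurable]: "R \<in> M \<rightarrow>\<^sub>M count_space UNIV"
    using indep[of 1] by (simp add: indep_rv_def)
  have R_prob: "prob (R -` {b} \<inter> space M) = pmf (bernoulli_pmf p) b" for b
    using measure_distr[OF R, of "{b}"] R_law by (simp add: measure_pmf_single)
  let ?h = "\<lambda>n y. if n = 0 then 1 - p
       else if \<exists>i<n. F2 (y i) \<in> {0, 1} then 0
       else p * f_star df F2 f2 \<rho>2 n z y *
         (count_cond_cdf df F2 \<rho>1 \<rho>2 n z (t_quantile df (F1 (real n))) y -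
          count_cond_cdf df F2 \<rho>1 \<rho>2 n z (t_quantile df (F1 (real n - 1))) y)"
  have zero: "prob {\<omega> \<in> space M. fst (collective_risk R Np Y \<omega>) = 0} = 1 - p"
  proof -
    \<comment> \<open>Since \<open>Np\<close> is at least 1, the count is zero exactly when
      \<open>R\<close> fails.\<close>
    have "{\<omega> \<in> space M. fst (collective_risk R Np Y \<omega>) = 0} = R -` {False} \<inter> space M"
      using Np1 by (force simp: collective_risk_def claim_count_def)
    thus ?thesis using p by (simp add: R_prob)
  qed
  have main: "?h n \<in> borel_measurable (PiM {..<n} (\<lambda>_. lborel)) \<and>
        (\<forall>y \<in> space (PiM {..<n} (\<lambda>_. lborel)). 0 \<le> ?h n y) \<and>
        (\<forall>B \<in> sets (PiM {..<n} (\<lambda>_. borel)).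
           emeasure M {\<omega> \<in> space M. fst (collective_risk R Np Y \<omega>) = n \<and> snd (collective_risk R Np Y \<omega>) \<in> B} =
           (\<integral>\<^sup>+ y \<in> B. ennreal (?h n y) \<partial>PiM {..<n} (\<lambda>_. lborel)))" if n: "n \<ge> 1" for n
  proof -
    note ctx = df n pdc pdj f2 f2_nonneg rd F2 cont
    define g where "g y = claims_density df F2 f2 \<rho>2 n z y *
       (count_cond_cdf df F2 \<rho>1 \<rho>2 n z (t_quantile df (F1 (real n))) y -
        count_cond_cdf df F2 \<rho>1 \<rho>2 n z (t_quantile df (F1 (real n - 1))) y)" for y
    \<comment> \<open>The boundary case of the formula is already contained in
      \<open>claims_density\<close>, which vanishes there.\<close>
    have h_eq: "?h n y = p * g y" if "y \<in> space (PiM {..<n} (\<lambda>_. lborel))" for y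
      using that n claims_density_eq[OF ctx, of y] by (auto simp: g_def space_PiM mult.assoc)
    have g_meas: "g \<in> borel_measurable (PiM {..<n} (\<lambda>_. borel))"
      unfolding g_def
      by (intro borel_measurable_times borel_measurable_diff claims_density_measurable[OF ctx]
          count_cond_cdf_measurable[OF ctx])
    hence g_meas' [measurable]: "g \<in> borel_measurable (PiM {..<n} (\<lambda>_. lborel))"
      by (simp add: measurable_cong_sets[OF sets_PiM_lborel refl])
    \<comment> \<open>The comparison of quantiles does not mention the Borel set of the lemma that
      supplies it; the empty set instantiates that parameter.\<close>
    have "{} \<in> sets (PiM {..<n} (\<lambda>_. borel :: real measure))" by simp
    note le = emeasure_claims_eq(2)[OF ctx prob_space_axioms model this]
    have g_nonneg: "0 \<le> g y" for y
      unfolding g_def using claims_density_nonneg[OF ctx] count_cond_cdf_mono[OF ctx le]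
      by (intro mult_nonneg_nonneg) auto
    have "emeasure M {\<omega> \<in> space M. fst (collective_risk R Np Y \<omega>) = n \<and> snd (collective_risk R Np Y \<omega>) \<in> B} =
           (\<integral>\<^sup>+ y \<in> B. ennreal (?h n y) \<partial>PiM {..<n} (\<lambda>_. lborel))"
      if B: "B \<in> sets (PiM {..<n} (\<lambda>_. borel))" for B
    proof -
      let ?X = "\<lambda>\<omega>. (Np \<omega>, restrict (\<lambda>i. Y i \<omega>) {..<n})"
      let ?T = "count_space UNIV \<Otimes>\<^sub>M PiM {..<n} (\<lambda>_. borel :: real measure)"
      have nB: "{n} \<times> B \<in> sets ?T" using B by (intro pair_measureI) auto
      have BM: "B \<in> sets (PiM {..<n} (\<lambda>_. lborel))" using B by (simp add: sets_PiM_lborel)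
      \<comment> \<open>A positive count forces \<open>R\<close> to hold, and then the observed
        vector consists of exactly the first \<open>n\<close> claims. The event becomes an
        intersection to which independence at level \<open>n\<close> applies.\<close>
      have "{\<omega> \<in> space M. fst (collective_risk R Np Y \<omega>) = n \<and> snd (collective_risk R Np Y \<omega>) \<in> B}
          = (R -` {True} \<inter> space M) \<inter> (?X -` ({n} \<times> B) \<inter> space M)"
        using n by (auto simp: collective_risk_def claim_count_def split: if_splits)
      moreover have "prob ((R -` {True} \<inter> space M) \<inter> (?X -` ({n} \<times> B) \<inter> space M))
          = prob (R -` {True} \<inter> space M) * prob (?X -` ({n} \<times> B) \<inter> space M)"
        using indep[OF n] nB unfolding indep_rv_def by (intro indep_setD) auto
      ultimately have "emeasure M {\<omega> \<in> space M. fst (collective_risk R Np Y \<omega>) = n \<and> snd (collective_risk R Np Y \<omega>) \<in> B}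
          = ennreal p * emeasure M (?X -` ({n} \<times> B) \<inter> space M)"
        using p by (simp add: emeasure_eq_measure R_prob ennreal_mult)
      also have "?X -` ({n} \<times> B) \<inter> space M = {\<omega> \<in> space M. Np \<omega> = n \<and> restrict (\<lambda>i. Y i \<omega>) {..<n} \<in> B}"
        by auto
      also have "emeasure M \<dots> = (\<integral>\<^sup>+ y. ennreal (g y) * indicator B y \<partial>PiM {..<n} (\<lambda>_. lborel))"
        unfolding g_def by (rule emeasure_claims_eq(1)[OF ctx prob_space_axioms model B])
      also have "ennreal p * \<dots> = (\<integral>\<^sup>+ y. ennreal p * (ennreal (g y) * indicator B y) \<partial>PiM {..<n} (\<lambda>_. lborel))"
        using BM by (intro nn_integral_cmult[symmetric]) simp
      also have "\<dots> = (\<integral>\<^sup>+ y \<in> B. ennreal (?h n y) \<partial>PiM {..<n} (\<lambda>_. lborel))"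
        using p g_nonneg by (intro nn_integral_cong) (simp only: h_eq, simp add: ennreal_mult mult.assoc)
      finally show ?thesis .
    qed
    moreover have "?h n \<in> borel_measurable (PiM {..<n} (\<lambda>_. lborel))"
    proof -
      have "(\<lambda>y. p * g y) \<in> borel_measurable (PiM {..<n} (\<lambda>_. lborel))" by measurable
      thus ?thesis using h_eq by (subst measurable_cong[where g = "\<lambda>y. p * g y"]) auto
    qed
    moreover have "\<forall>y \<in> space (PiM {..<n} (\<lambda>_. lborel)). 0 \<le> ?h n y"
    proof
      fix y assume "y \<in> space (PiM {..<n} (\<lambda>_. lborel :: real measure))"
      from h_eq[OF this] show "0 \<le> ?h n y" using p g_nonneg[of y] by simp
    qed
    ultimately show ?thesis by blast
  qed
  show ?thesis
    unfolding is_joint_density_def count_cond_cdf_def[symmetric]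
    using zero main by auto
qed

end
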